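(* Let $w\in L^1([-1,1])$, $w\ge 0$, with $\int_{-1}^1 w(x)\,dx=1$, and assume $w$ belongs to the Szeg\H{o} class, i.e. $\log(w_0)\in L^1(\rho)$, where $\rho(x)=1/(\pi\sqrt{1-x^2})$ and $w_0(x)=\pi\sqrt{1-x^2}\,w(x)$. Let $(p_n)_{n\ge0}$ be the orthonormal polynomials with respect to $w(x)\,dx$ on $[-1,1]$, let $f_n(x)=p_n(x)\sqrt{w_0(x)}$ and, for $M>0$, $\Delta_n(M)=\{x\in[-1,1]: |f_n(x)|\ge M\}$. Then for every $M>\sqrt{2}$, $$E_n(w)=S(\rho,w)+\log 2-1-\int_{\Delta_n(M)} p_n^2(x)\log^+(p_n^2(x))\,w(x)\,dx+o(1),\qquad n\to\infty,$$ where $E_n(w)=-\int_{-1}^1 p_n^2(x)\log(p_n^2(x))\,w(x)\,dx$ and $S(\rho,w)=\int_{-1}^1\log(w_0(x))\,\rho(x)\,dx$.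
   Context: Orthonormal polynomials: $p_n$ has degree $n$, positive leading coefficient, and $\int_{-1}^1 p_np_m w\,dx=\delta_{mn}$. $\log^+(x)=\max\{\log x,0\}$ for $x>0$. $S(\rho,w)$ is the mutual entropy $-\int\log\big(\rho/w\big)\rho\,dx$, which equals $\int \log(w_0)\rho\,dx$. *)

theory Defs
  imports "HOL-Analysis.Analysis" "HOL-Computational_Algebra.Polynomial"
begin

text \<open>Positive part of the logarithm; note Isabelle's ln 0 = 0, so log_plus 0 = 0.\<close>
definition log_plus :: "real \<Rightarrow> real" where
  "log_plus x = max (ln x) 0"

definition cheb_rho :: "real \<Rightarrow> real" where
  "cheb_rho x = 1 / (pi * sqrt (1 - x\<^sup>2))"

definition w_zero :: "(real \<Rightarrow> real) \<Rightarrow> real \<Rightarrow> real" where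
  "w_zero w x = pi * sqrt (1 - x\<^sup>2) * w x"

definition orthonormal_polys :: "(real \<Rightarrow> real) \<Rightarrow> (nat \<Rightarrow> real poly) \<Rightarrow> bool" where
  "orthonormal_polys w p \<longleftrightarrow>
     (\<forall>n. degree (p n) = n \<and> lead_coeff (p n) > 0) \<and>
     (\<forall>m n. (LINT x:{-1..1}|lborel. poly (p n) x * poly (p m) x * w x)
              = (if m = n then 1 else 0))"

definition entropy_E :: "(real \<Rightarrow> real) \<Rightarrow> real poly \<Rightarrow> real" where
  "entropy_E w q = - (LINT x:{-1..1}|lborel. (poly q x)\<^sup>2 * ln ((poly q x)\<^sup>2) * w x)"

definition mutual_entropy_S :: "(real \<Rightarrow> real) \<Rightarrow> real" where
  "mutual_entropy_S w = (LINT x:{-1..1}|lborel. ln (w_zero w x) * cheb_rho x)"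

definition Delta_set :: "(real \<Rightarrow> real) \<Rightarrow> real poly \<Rightarrow> real \<Rightarrow> real set" where
  "Delta_set w q M = {x \<in> {-1..1}. \<bar>poly q x * sqrt (w_zero w x)\<bar> \<ge> M}"

end

theory Submission
  imports Defs "HOL-Complex_Analysis.Complex_Analysis" "HOL-Probability.Probability_Measure"
    "HOL-Real_Asymp.Real_Asymp"
begin

text \<open>
  Put \<open>x = cos t\<close> and let \<open>v t = w\<^sub>0 (cos t)\<close>, \<open>z = e\<^sup>i\<^sup>t\<close>; then \<open>F\<^sub>n t = p\<^sub>n (cos t) sqrt (v t)\<close> has norm 1 in
  \<open>L\<^sup>2\<close> of the normalised measure on \<open>[0, pi]\<close>. Everything rests on the asymptotics
  \<open>F\<^sub>n - sqrt 2 Re (u z\<^sup>n) \<rightarrow> 0\<close> in \<open>L\<^sup>2\<close> for a fixed unimodular function \<open>u\<close>.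

  The Szego function is avoided. Minimise \<open>N h = \<integral> |h(z)|\<^sup>2 v\<close> over real polynomials with \<open>h(0) = 1\<close>.
  The infimum \<open>d\<close> is positive: \<open>N h \<ge> exp (\<integral> ln v)\<close> by Jensen's inequality and \<open>\<integral> ln |h(z)| \<ge> ln |h(0)|\<close>.
  A minimising sequence converges to some \<open>g\<close> that is orthogonal to \<open>z\<^sup>j h sqrt v\<close> for \<open>j \<ge> 1\<close>, hence to
  \<open>z\<^sup>j g\<close>; so all cosine coefficients of \<open>|g|\<^sup>2\<close> but the zeroth vanish and \<open>|g|\<^sup>2 = d\<close> almost everywhere.
  With \<open>u = cnj g / sqrt d\<close> the inner product of \<open>F\<^sub>n\<close> and \<open>sqrt 2 Re (u z\<^sup>n)\<close> is
  \<open>k\<^sub>n 2\<^sup>-\<^sup>n sqrt (2 d)\<close>, where \<open>k\<^sub>n\<close> is the leading coefficient of \<open>p\<^sub>n\<close>, and comparing \<open>p\<^sub>n\<close> with the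
  polynomial \<open>2 Re (z\<^sup>n cnj (h(z)))\<close> in \<open>cos t\<close> shows that this tends to 1.

  Off \<open>\<Delta>\<^sub>n(M)\<close> the integrand is \<open>F\<^sub>n\<^sup>2 ln F\<^sub>n\<^sup>2 - F\<^sub>n\<^sup>2 ln v\<close> with \<open>F\<^sub>n\<close> bounded, so \<open>F\<^sub>n\<close> may be replaced by
  \<open>sqrt 2 Re (u z\<^sup>n)\<close>, whose values are equidistributed like \<open>sqrt 2 cos t\<close>; on \<open>\<Delta>\<^sub>n(M)\<close>, whose measure tends
  to 0 since \<open>M > sqrt 2\<close>, only \<open>p\<^sub>n\<^sup>2 log\<^sup>- (p\<^sub>n\<^sup>2) w \<le> w\<close> is neglected.
\<close>

section \<open>The uniform measure on \<open>[0, pi]\<close> and the arcsine law\<close>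

definition arc_measure :: "real measure" where
  "arc_measure = uniform_measure lborel {0..pi}"

lemma sets_arc_measure [simp, measurable_cong]: "sets arc_measure = sets borel"
  by (simp add: arc_measure_def)

lemma space_arc_measure [simp]: "space arc_measure = UNIV"
  by (simp add: arc_measure_def)

global_interpretation arc: prob_space arc_measure
  unfolding arc_measure_def by (rule prob_space_uniform_measure) auto

lemma measure_arc_measure_UNIV [simp]: "measure arc_measure UNIV = 1"
  using arc.prob_space by simp

lemma AE_arc_measure_iff: "(AE t in arc_measure. P t) \<longleftrightarrow> (AE t in lborel. t \<in> {0..pi} \<longrightarrow> P t)"
  unfolding arc_measure_def by (rule AE_uniform_measure) auto

lemma arc_measure_eq_density: "arc_measure = density lborel (\<lambda>t. ennreal (indicator {0..pi} t / pi))"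
  unfolding arc_measure_def uniform_measure_def using divide_ennreal[of 1 pi]
  by (intro density_cong AE_I2) (auto split: split_indicator)

lemma integral_arc_measure_continuous:
  fixes f :: "real \<Rightarrow> 'b::euclidean_space"
  assumes "continuous_on UNIV f"
  shows "integral\<^sup>L arc_measure f = integral {0..pi} f /\<^sub>R pi"
proof -
  have [measurable]: "f \<in> borel_measurable borel"
    by (rule borel_measurable_continuous_onI[OF assms])
  have "integral\<^sup>L arc_measure f = (\<integral>t. (indicator {0..pi} t *\<^sub>R f t) /\<^sub>R pi \<partial>lborel)"
    unfolding arc_measure_eq_density by (subst integral_density) (auto simp: divide_inverse_commute)
  also have "\<dots> = (LINT t:{0..pi}|lborel. f t) /\<^sub>R pi"
    unfolding set_lebesgue_integral_def by (rule integral_scaleR_right)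
  also have "(LINT t:{0..pi}|lborel. f t) = integral {0..pi} f"
    using assms by (intro set_borel_integral_eq_integral borel_integrable_atLeastAtMost')
      (auto intro: continuous_on_subset)
  finally show ?thesis .
qed

lemma integrable_arc_measure_continuous:
  fixes f :: "real \<Rightarrow> 'b::euclidean_space"
  assumes "continuous_on UNIV f"
  shows "integrable arc_measure f"
proof -
  obtain B where "\<And>t. t \<in> {0..pi} \<Longrightarrow> norm (f t) \<le> B"
    using continuous_on_compact_bound[OF compact_Icc continuous_on_subset[OF assms subset_UNIV]] by blast
  then show ?thesis
    using borel_measurable_continuous_onI[OF assms]
    by (intro arc.integrable_const_bound[where B=B]) (auto simp: AE_arc_measure_iff)
qed

lemma AE_sin_pos: "AE t in lborel. t \<in> {0..pi} \<longrightarrow> 0 < sin t"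
proof -
  have "AE t in lborel. t \<noteq> 0 \<and> t \<noteq> pi"
    by (intro AE_conjI AE_lborel_singleton)
  then show ?thesis
    by eventually_elim (auto intro!: sin_gt_zero)
qed

lemma cheb_rho_cos: "0 < sin t \<Longrightarrow> cheb_rho (cos t) * sin t = 1 / pi"
  by (simp add: cheb_rho_def flip: sin_squared_eq)

lemma cheb_rho_minus: "cheb_rho (- x) = cheb_rho x"
  by (simp add: cheb_rho_def)

lemma borel_measurable_cheb_rho [measurable]: "cheb_rho \<in> borel_measurable borel"
  unfolding cheb_rho_def by measurable

lemma distr_arc_measure_cos:
  "distr arc_measure borel cos = density lborel (\<lambda>x. ennreal (indicator {-1..1} x * cheb_rho x))"
proof (rule measure_eqI)
  fix A :: "real set"
  assume "A \<in> sets (distr arc_measure borel cos)"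
  then have [measurable]: "A \<in> sets borel"
    by simp
  define f :: "real \<Rightarrow> ennreal" where "f x = ennreal (cheb_rho x) * indicator A (- x)" for x
  have "emeasure (density lborel (\<lambda>x. ennreal (indicator {-1..1} x * cheb_rho x))) A
      = (\<integral>\<^sup>+x. ennreal (indicator {-1..1} x * cheb_rho x) * indicator A x \<partial>lborel)"
    by (subst emeasure_density) auto
  also have "\<dots> = (\<integral>\<^sup>+x. f x * indicator {- cos 0..- cos pi} x \<partial>lborel)"
    by (subst nn_integral_real_affine[where c="- 1" and t=0])
      (auto intro!: nn_integral_cong simp: f_def cheb_rho_minus split: split_indicator)
  also have "\<dots> = (\<integral>\<^sup>+t. f (- cos t) * ennreal (sin t) * indicator {0..pi} t \<partial>lborel)"
    by (rule nn_integral_substitution_aux)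
      (auto intro!: derivative_eq_intros continuous_intros sin_ge_zero simp: f_def)
  also have "\<dots> = (\<integral>\<^sup>+t. indicator A (cos t) * indicator {0..pi} t / ennreal pi \<partial>lborel)"
  proof (rule nn_integral_cong_AE)
    show "AE t in lborel. f (- cos t) * ennreal (sin t) * indicator {0..pi} t
        = indicator A (cos t) * indicator {0..pi} t / ennreal pi"
      using AE_sin_pos
    proof eventually_elim
      case (elim t)
      show ?case
      proof (cases "t \<in> {0..pi}")
        case True
        with elim have "f (- cos t) * ennreal (sin t)
            = indicator A (cos t) * ennreal (cheb_rho (cos t) * sin t)"
          using ennreal_mult''[of "sin t" "cheb_rho (cos t)"] by (simp add: f_def cheb_rho_minus mult_ac)
        with True elim show ?thesis
          by (simp add: cheb_rho_cos divide_ennreal_def inverse_ennreal divide_inverse)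
      qed simp
    qed
  qed
  also have "\<dots> = (\<integral>\<^sup>+t. indicator A (cos t) \<partial>arc_measure)"
    unfolding arc_measure_def by (simp add: nn_integral_uniform_measure nn_integral_divide)
  also have "\<dots> = emeasure (distr arc_measure borel cos) A"
    by (simp add: nn_integral_distr[symmetric] flip: nn_integral_indicator)
  finally show "emeasure (distr arc_measure borel cos) A
      = emeasure (density lborel (\<lambda>x. ennreal (indicator {-1..1} x * cheb_rho x))) A"
    by simp
qed simp

lemma AE_arc_measure_cos:
  assumes "AE x in lborel. x \<in> {-1..1} \<longrightarrow> P x"
  shows "AE t in arc_measure. P (cos t)"
proof (rule AE_distrD[where f=cos and M'=borel])
  have "AE x in lborel. 0 < ennreal (indicator {-1..1} x * cheb_rho x) \<longrightarrow> P x"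
    using assms by eventually_elim (auto split: split_indicator)
  then show "AE x in distr arc_measure borel cos. P x"
    unfolding distr_arc_measure_cos by (simp add: AE_density)
qed simp

lemma
  fixes f :: "real \<Rightarrow> real"
  assumes "f \<in> borel_measurable (restrict_space borel {-1..1})"
  shows integrable_arc_measure_cos_iff:
      "integrable arc_measure (\<lambda>t. f (cos t)) \<longleftrightarrow> set_integrable lborel {-1..1} (\<lambda>x. f x * cheb_rho x)"
    and integral_arc_measure_cos:
      "(\<integral>t. f (cos t) \<partial>arc_measure) = (LINT x:{-1..1}|lborel. f x * cheb_rho x)"
proof -
  define h where "h x = indicator {-1..1} x *\<^sub>R f x" for x
  have [measurable]: "h \<in> borel_measurable borel"
    using assms unfolding h_def by (simp add: borel_measurable_restrict_space_iff)
  have h_cos: "f (cos t) = h (cos t)" for t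
    by (simp add: h_def)
  have density: "(indicator {-1..1} x * cheb_rho x) *\<^sub>R h x = indicator {-1..1} x *\<^sub>R (f x * cheb_rho x)" for x
    by (simp add: h_def split: split_indicator)
  have nonneg: "AE x in lborel. 0 \<le> indicator {-1..1} x * cheb_rho x"
    by (auto simp: cheb_rho_def abs_square_le_1 abs_le_iff split: split_indicator)
  show "integrable arc_measure (\<lambda>t. f (cos t)) \<longleftrightarrow> set_integrable lborel {-1..1} (\<lambda>x. f x * cheb_rho x)"
    unfolding h_cos set_integrable_def density[symmetric] using nonneg
    by (subst integrable_density[symmetric]) (auto simp: integrable_distr_eq simp flip: distr_arc_measure_cos)
  show "(\<integral>t. f (cos t) \<partial>arc_measure) = (LINT x:{-1..1}|lborel. f x * cheb_rho x)"
    unfolding h_cos set_lebesgue_integral_def density[symmetric] using nonneg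
    by (subst integral_density[symmetric]) (auto simp: integral_distr simp flip: distr_arc_measure_cos)
qed

section \<open>Chebyshev polynomials\<close>

fun Chebyshev_T :: "nat \<Rightarrow> real poly" where
  "Chebyshev_T 0 = 1"
| "Chebyshev_T (Suc 0) = [:0, 1:]"
| "Chebyshev_T (Suc (Suc n)) = [:0, 2:] * Chebyshev_T (Suc n) - Chebyshev_T n"

lemma poly_Chebyshev_T_Re:
  assumes "norm z = 1"
  shows "poly (Chebyshev_T n) (Re z) = Re (z ^ n)"
proof (induction n rule: Chebyshev_T.induct)
  case (3 n)
  have "z * cnj z = 1"
    using complex_norm_square[of z] assms by simp
  moreover have "(z + cnj z) * z ^ Suc n = z ^ Suc (Suc n) + (z * cnj z) * z ^ n"
    by (simp add: algebra_simps)
  ultimately have "z ^ Suc (Suc n) = complex_of_real (2 * Re z) * z ^ Suc n - z ^ n"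
    unfolding complex_add_cnj by (simp add: algebra_simps)
  with 3 show ?case
    by simp
qed simp_all

corollary poly_Chebyshev_T_cos: "poly (Chebyshev_T n) (cos t) = cos (real n * t)"
  using poly_Chebyshev_T_Re[of "cis t" n] by (simp add: Complex.DeMoivre)

lemma degree_Chebyshev_T_le: "degree (Chebyshev_T n) \<le> n"
proof (induction n rule: Chebyshev_T.induct)
  case (3 n)
  have "degree ([:0, 2:] * Chebyshev_T (Suc n)) \<le> degree [:0, 2::real:] + degree (Chebyshev_T (Suc n))"
    by (rule degree_mult_le)
  with 3 show ?case
    by (auto intro!: degree_diff_le)
qed simp_all

lemma coeff_Chebyshev_T: "coeff (Chebyshev_T n) n = 2 ^ (n - 1)"
proof (induction n rule: Chebyshev_T.induct)
  case (3 n)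
  have "coeff (Chebyshev_T n) (Suc (Suc n)) = 0"
    using degree_Chebyshev_T_le[of n] by (intro coeff_eq_0) simp
  with 3 show ?case
    by simp
qed simp_all

lemma Chebyshev_T_induct [case_names Chebyshev_T add smult]:
  assumes Chebyshev_T: "\<And>n. P (Chebyshev_T n)"
    and add: "\<And>q r. P q \<Longrightarrow> P r \<Longrightarrow> P (q + r)"
    and smult: "\<And>c q. P q \<Longrightarrow> P (smult c q)"
  shows "P q"
proof (induction "degree q" arbitrary: q rule: less_induct)
  case less
  define n where "n = degree q"
  define c where "c = coeff q n / 2 ^ (n - 1)"
  define r where "r = q - smult c (Chebyshev_T n)"
  have "degree r \<le> n"
    unfolding r_def
    by (intro degree_diff_le order_trans[OF degree_smult_le] degree_Chebyshev_T_le) (simp add: n_def)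
  moreover have "coeff r n = 0"
    by (simp add: r_def c_def coeff_Chebyshev_T)
  ultimately consider "r = 0" | "degree r < degree q"
    using eq_zero_or_degree_less unfolding n_def by blast
  then have "P r"
    using less smult[OF Chebyshev_T, of 0] by cases auto
  then have "P (smult c (Chebyshev_T n) + r)"
    by (intro add smult Chebyshev_T)
  then show ?case
    by (simp add: r_def)
qed

section \<open>Approximation by cosine polynomials\<close>

lemma borel_measurable_poly [measurable]:
  fixes q :: "'a :: real_normed_field poly"
  shows "poly q \<in> borel_measurable borel"
  by (intro borel_measurable_continuous_onI continuous_intros)

lemma borel_measurable_cis [measurable]: "cis \<in> borel_measurable borel"
  by (intro borel_measurable_continuous_onI continuous_intros)

lemma borel_measurable_cnj [measurable]: "cnj \<in> borel_measurable borel"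
  by (intro borel_measurable_continuous_onI continuous_intros)

lemma integrable_arc_measure_bounded:
  fixes f :: "real \<Rightarrow> 'b::{banach, second_countable_topology}"
  assumes "f \<in> borel_measurable borel" "\<And>t. norm (f t) \<le> C"
  shows "integrable arc_measure f"
  using assms by (intro arc.integrable_const_bound[where B=C]) auto

lemma integrable_mult_bounded:
  fixes f g :: "'a \<Rightarrow> 'b::{banach, second_countable_topology, real_normed_algebra}"
  assumes "integrable M f" "g \<in> borel_measurable M" "\<And>x. norm (g x) \<le> C"
  shows "integrable M (\<lambda>x. f x * g x)"
proof (rule Bochner_Integration.integrable_bound[where f="\<lambda>x. C * norm (f x)"])
  have "norm (f x * g x) \<le> norm (C * norm (f x))" for x
  proof -
    have "norm (f x * g x) \<le> norm (f x) * norm (g x)"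
      by (rule norm_mult_ineq)
    also have "\<dots> \<le> norm (f x) * C"
      by (intro mult_left_mono assms) auto
    finally show ?thesis
      by (simp add: mult.commute)
  qed
  then show "AE x in M. norm (f x * g x) \<le> norm (C * norm (f x))"
    by simp
qed (use assms in auto)

lemma integrable_mult_continuous_compose:
  fixes f :: "'a \<Rightarrow> 'b::{banach, second_countable_topology, real_normed_algebra}" and \<phi> :: "real \<Rightarrow> 'b"
  assumes f: "integrable M f" and \<phi>: "continuous_on UNIV \<phi>"
    and [measurable]: "x \<in> borel_measurable M" and x: "\<And>t. x t \<in> {a..b}"
  shows "integrable M (\<lambda>t. f t * \<phi> (x t))"
proof -
  obtain B where B: "\<And>y. y \<in> {a..b} \<Longrightarrow> norm (\<phi> y) \<le> B"
    using continuous_on_compact_bound[OF compact_Icc continuous_on_subset[OF \<phi> subset_UNIV]] by blast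
  have [measurable]: "\<phi> \<in> borel_measurable borel"
    by (rule borel_measurable_continuous_onI[OF \<phi>])
  show ?thesis
    by (intro integrable_mult_bounded[where C=B] f B x) auto
qed

corollary integrable_mult_continuous_cos:
  fixes f \<phi> :: "real \<Rightarrow> 'b::{banach, second_countable_topology, real_normed_algebra}"
  assumes "integrable arc_measure f" "continuous_on UNIV \<phi>"
  shows "integrable arc_measure (\<lambda>t. f t * \<phi> (cos t))"
  by (rule integrable_mult_continuous_compose[OF assms, where a="- 1" and b=1]) auto

lemma integrable_poly_cos: "integrable arc_measure (\<lambda>t. poly q (cos t) :: real)"
  by (intro integrable_arc_measure_continuous continuous_intros)

lemma Weierstrass_poly_uniform_limit:
  fixes f :: "real \<Rightarrow> real"
  assumes "continuous_on {a..b} f"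
  obtains q :: "nat \<Rightarrow> real poly" where "uniform_limit {a..b} (\<lambda>k. poly (q k)) f sequentially"
proof -
  obtain g where g: "uniform_limit {a..b} g f sequentially" "\<And>k. polynomial_function (g k)"
    using Stone_Weierstrass_uniform_limit[OF compact_Icc assms] by blast
  have "\<exists>q. g k = poly q" for k
  proof -
    obtain c n where "g k = (\<lambda>x. \<Sum>i\<le>n. c i * x ^ i)"
      using g(2)[of k] by (auto simp: real_polynomial_function_iff_sum simp flip: real_polynomial_function_eq)
    then have "g k = poly (\<Sum>i\<le>n. monom (c i) i)"
      by (simp add: fun_eq_iff poly_sum poly_monom)
    then show ?thesis ..
  qed
  then obtain q where "g = (\<lambda>k. poly (q k))"
    by metis
  with g(1) show ?thesis
    using that by blast
qed

lemma bounded_borel_AE_limit_continuous: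
  fixes f :: "real \<Rightarrow> real"
  assumes "f \<in> borel_measurable borel" and f_le: "\<And>t. \<bar>f t\<bar> \<le> C"
  obtains g where "\<And>n. continuous_on UNIV (g n)" "\<And>n t. \<bar>g n t\<bar> \<le> C"
    "AE t in lborel. (\<lambda>n::nat. g n t) \<longlonglongrightarrow> f t"
proof -
  have "f measurable_on UNIV"
    using assms by (intro lebesgue_measurable_imp_measurable_on) (auto simp: measurable_completion)
  then obtain N g where N: "negligible N" and g: "\<And>n. continuous_on UNIV (g n)"
    and lim: "\<And>t. t \<notin> N \<Longrightarrow> (\<lambda>n. g n t) \<longlonglongrightarrow> f t"
    unfolding measurable_on_def by auto
  show ?thesis
  proof
    show "continuous_on UNIV (\<lambda>t. max (- C) (min C (g n t)))" for n
      by (intro continuous_intros g)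
    show "\<bar>max (- C) (min C (g n t))\<bar> \<le> C" for n t
      using f_le[of t] by auto
    have "(\<lambda>n. max (- C) (min C (g n t))) \<longlonglongrightarrow> max (- C) (min C (f t))" if "t \<notin> N" for t
      by (intro tendsto_intros lim that)
    moreover have "max (- C) (min C (f t)) = f t" for t
      using f_le[of t] by auto
    moreover have "AE t in lborel. t \<notin> N"
      using N unfolding negligible_iff_null_sets by (metis AE_not_in AE_completion_iff)
    ultimately show "AE t in lborel. (\<lambda>n. max (- C) (min C (g n t))) \<longlonglongrightarrow> f t"
      by auto
  qed
qed

lemma exists_poly_cos_near:
  fixes g :: "real \<Rightarrow> real"
  assumes "continuous_on UNIV g" "0 < e"
  shows "\<exists>q. \<forall>t\<in>{0..pi}. \<bar>poly q (cos t) - g t\<bar> < e"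
proof -
  have "continuous_on {-1..1} (\<lambda>x. g (arccos x))"
    by (rule continuous_on_compose2[OF assms(1)]) (auto intro!: continuous_intros)
  then obtain q where "uniform_limit {-1..1} (\<lambda>k. poly (q k)) (\<lambda>x. g (arccos x)) sequentially"
    by (rule Weierstrass_poly_uniform_limit)
  from uniform_limitD[OF this \<open>0 < e\<close>] obtain k where k: "\<forall>x\<in>{-1..1}. dist (poly (q k) x) (g (arccos x)) < e"
    unfolding eventually_sequentially by blast
  have "\<bar>poly (q k) (cos t) - g t\<bar> < e" if "t \<in> {0..pi}" for t
    using bspec[OF k, of "cos t"] that by (simp add: dist_real_def arccos_cos)
  then show ?thesis
    by blast
qed

lemma bounded_borel_AE_limit_poly_cos:
  fixes f :: "real \<Rightarrow> real"
  assumes "f \<in> borel_measurable borel" and "\<And>t. \<bar>f t\<bar> \<le> C"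
  obtains q :: "nat \<Rightarrow> real poly" where "\<And>n t. \<bar>poly (q n) (cos t)\<bar> \<le> C + 1"
    "AE t in arc_measure. (\<lambda>n. poly (q n) (cos t)) \<longlonglongrightarrow> f t"
proof -
  obtain g where g: "\<And>n. continuous_on UNIV (g n)" and g_le: "\<And>n t. \<bar>g n t\<bar> \<le> C"
    and g_lim: "AE t in lborel. (\<lambda>n::nat. g n t) \<longlonglongrightarrow> f t"
    using bounded_borel_AE_limit_continuous[OF assms] by blast
  have "\<exists>q. \<forall>t\<in>{0..pi}. \<bar>poly q (cos t) - g n t\<bar> < inverse (real (Suc n))" for n
    by (intro exists_poly_cos_near g) simp
  then obtain q where q: "\<And>n t. t \<in> {0..pi} \<Longrightarrow> \<bar>poly (q n) (cos t) - g n t\<bar> < inverse (real (Suc n))"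
    by metis
  show ?thesis
  proof
    fix n t
    have "\<bar>poly (q n) (cos t) - g n (arccos (cos t))\<bar> < inverse (real (Suc n))"
      using q[of "arccos (cos t)" n] by (simp add: arccos_lbound arccos_ubound)
    moreover have "inverse (real (Suc n)) \<le> 1"
      by (simp add: inverse_le_1_iff)
    ultimately show "\<bar>poly (q n) (cos t)\<bar> \<le> C + 1"
      using g_le[of n "arccos (cos t)"] by linarith
  next
    have "(\<lambda>n. poly (q n) (cos t)) \<longlonglongrightarrow> f t" if "(\<lambda>n. g n t) \<longlonglongrightarrow> f t" "t \<in> {0..pi}" for t
    proof (rule Lim_transform[OF that(1)])
      have "norm (poly (q n) (cos t) - g n t) \<le> inverse (real (Suc n))" for n
        using q[OF that(2), of n] by simp
      then show "(\<lambda>n. poly (q n) (cos t) - g n t) \<longlonglongrightarrow> 0"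
        by (intro Lim_null_comparison[OF _ LIMSEQ_inverse_real_of_nat] always_eventually allI)
    qed
    with g_lim show "AE t in arc_measure. (\<lambda>n. poly (q n) (cos t)) \<longlonglongrightarrow> f t"
      unfolding AE_arc_measure_iff by auto
  qed
qed

lemma Fourier_cosine_unique:
  fixes f :: "real \<Rightarrow> real"
  assumes f: "integrable arc_measure f"
    and cos_coeff: "\<And>n::nat. (\<integral>t. f t * cos (real n * t) \<partial>arc_measure) = 0"
  shows "AE t in arc_measure. f t = 0"
proof -
  have [measurable]: "f \<in> borel_measurable borel"
    using borel_measurable_integrable[OF f] by simp
  have int: "integrable arc_measure (\<lambda>t. f t * poly q (cos t))" for q
    by (intro integrable_mult_continuous_cos f continuous_intros)
  have poly_coeff: "(\<integral>t. f t * poly q (cos t) \<partial>arc_measure) = 0" for q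
  proof (induction q rule: Chebyshev_T_induct)
    case (Chebyshev_T n)
    then show ?case
      by (simp add: poly_Chebyshev_T_cos cos_coeff)
  next
    case (add q r)
    then show ?case
      using int by (simp add: distrib_left)
  next
    case (smult c q)
    then show ?case
      by (simp add: mult.left_commute)
  qed
  obtain q where q_le: "\<And>n t. \<bar>poly (q n) (cos t)\<bar> \<le> 1 + 1"
    and q_lim: "AE t in arc_measure. (\<lambda>n. poly (q n) (cos t)) \<longlonglongrightarrow> sgn (f t)"
    by (rule bounded_borel_AE_limit_poly_cos[of "\<lambda>t. sgn (f t)" 1]) (auto simp: abs_sgn_eq)
  have "(\<lambda>n. \<integral>t. f t * poly (q n) (cos t) \<partial>arc_measure) \<longlonglongrightarrow> (\<integral>t. f t * sgn (f t) \<partial>arc_measure)"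
  proof (rule integral_dominated_convergence[where w="\<lambda>t. \<bar>f t\<bar> * 2"])
    show "AE t in arc_measure. (\<lambda>n. f t * poly (q n) (cos t)) \<longlonglongrightarrow> f t * sgn (f t)"
      using q_lim by eventually_elim (intro tendsto_intros)
    show "AE t in arc_measure. norm (f t * poly (q n) (cos t)) \<le> \<bar>f t\<bar> * 2" for n
      using q_le[of n] by (intro AE_I2) (auto simp: abs_mult intro!: mult_left_mono)
  qed (use f in auto)
  then have "(\<integral>t. \<bar>f t\<bar> \<partial>arc_measure) = 0"
    by (simp add: poly_coeff LIMSEQ_const_iff abs_sgn)
  then show ?thesis
    using f by (subst (asm) integral_nonneg_eq_0_iff_AE) auto
qed

section \<open>The Riemann--Lebesgue lemma\<close>

lemma uniform_limit_dist_leI: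
  assumes "\<And>n x. x \<in> S \<Longrightarrow> dist (f n x) (l x) \<le> d n" and "(d \<longlongrightarrow> 0) F"
  shows "uniform_limit S f l F"
proof (rule uniform_limitI)
  fix e :: real
  assume "0 < e"
  then have "\<forall>\<^sub>F n in F. d n < e"
    by (rule order_tendstoD(2)[OF assms(2)])
  then show "\<forall>\<^sub>F n in F. \<forall>x\<in>S. dist (f n x) (l x) < e"
    by eventually_elim (use assms(1) le_less_trans in blast)
qed

lemma integral_norm_diff_dominated_tendsto_0:
  fixes f :: "'a \<Rightarrow> 'b::{banach, second_countable_topology}"
  assumes [measurable]: "f \<in> borel_measurable M" "\<And>k. s k \<in> borel_measurable M"
    and w: "integrable M w" and s_lim: "AE x in M. (\<lambda>k. s k x) \<longlonglongrightarrow> f x"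
    and s_le: "\<And>k. AE x in M. norm (s k x) \<le> w x"
  shows "(\<lambda>k. \<integral>x. norm (s k x - f x) \<partial>M) \<longlonglongrightarrow> 0"
proof -
  have f: "integrable M f"
    using integrable_dominated_convergence[OF assms(1,2) w s_lim s_le] .
  have "(\<lambda>k. \<integral>x. norm (s k x - f x) \<partial>M) \<longlonglongrightarrow> (\<integral>x. 0 \<partial>M)"
  proof (rule integral_dominated_convergence[where w="\<lambda>x. w x + norm (f x)"])
    show "AE x in M. (\<lambda>k. norm (s k x - f x)) \<longlonglongrightarrow> 0"
      using s_lim by eventually_elim (intro tendsto_norm_zero LIM_zero)
    show "AE x in M. norm (norm (s k x - f x)) \<le> w x + norm (f x)" for k
      using s_le[of k] by eventually_elim (auto intro: order_trans[OF norm_triangle_ineq4])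
  qed (use w f in auto)
  then show ?thesis
    by simp
qed

lemma integral_mult_tendsto_0_dominated_limit:
  fixes f :: "'a \<Rightarrow> 'b::{banach, second_countable_topology, real_normed_algebra_1}"
    and s :: "nat \<Rightarrow> 'a \<Rightarrow> 'b"
  assumes [measurable]: "f \<in> borel_measurable M" "\<And>k. s k \<in> borel_measurable M" "\<And>c. g c \<in> borel_measurable M"
    and w: "integrable M w" and s_le: "\<And>k. AE x in M. norm (s k x) \<le> w x"
    and s_lim: "AE x in M. (\<lambda>k. s k x) \<longlonglongrightarrow> f x"
    and g_le: "\<And>c x. norm (g c x) \<le> 1"
    and lim: "\<And>k. ((\<lambda>c. \<integral>x. s k x * g c x \<partial>M) \<longlongrightarrow> 0) F"
  shows "((\<lambda>c. \<integral>x. f x * g c x \<partial>M) \<longlongrightarrow> 0) F"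
proof (rule swap_uniform_limit')
  have int: "integrable M f" "\<And>k. integrable M (s k)"
    using integrable_dominated_convergence[OF assms(1,2) w s_lim s_le]
      integrable_dominated_convergence2[OF assms(1,2) w s_lim s_le] by this+
  show "uniform_limit UNIV (\<lambda>k c. \<integral>x. s k x * g c x \<partial>M) (\<lambda>c. \<integral>x. f x * g c x \<partial>M) sequentially"
  proof (rule uniform_limit_dist_leI[OF _ integral_norm_diff_dominated_tendsto_0[OF assms(1,2) w s_lim s_le]])
    fix k c
    have int_g: "integrable M (\<lambda>x. f x * g c x)" "integrable M (\<lambda>x. s k x * g c x)"
      by (intro integrable_mult_bounded[where C=1] int g_le; simp)+
    have "dist (\<integral>x. s k x * g c x \<partial>M) (\<integral>x. f x * g c x \<partial>M) = norm (\<integral>x. (s k x - f x) * g c x \<partial>M)"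
      using int_g by (simp add: dist_norm left_diff_distrib)
    also have "\<dots> \<le> (\<integral>x. norm ((s k x - f x) * g c x) \<partial>M)"
      by (rule integral_norm_bound)
    also have "\<dots> \<le> (\<integral>x. norm (s k x - f x) \<partial>M)"
    proof (rule integral_mono)
      show "norm ((s k x - f x) * g c x) \<le> norm (s k x - f x)" for x
        using norm_mult_ineq[of "s k x - f x" "g c x"] mult_left_le[OF g_le norm_ge_zero] by (rule order_trans)
      show "integrable M (\<lambda>x. norm ((s k x - f x) * g c x))"
        using int_g by (simp add: left_diff_distrib)
    qed (use int in auto)
    finally show "dist (\<integral>x. s k x * g c x \<partial>M) (\<integral>x. f x * g c x \<partial>M) \<le> (\<integral>x. norm (s k x - f x) \<partial>M)" .
  qed
qed (use lim in auto)

lemma integral_cis_tendsto_0: "((\<lambda>c. \<integral>t. cis (c * t) \<partial>arc_measure) \<longlongrightarrow> 0) at_top"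
proof (rule Lim_null_comparison)
  show "\<forall>\<^sub>F c in at_top. norm (\<integral>t. cis (c * t) \<partial>arc_measure) \<le> 2 / (pi * c)"
    using eventually_gt_at_top[of 0]
  proof eventually_elim
    case (elim c)
    have "((\<lambda>t. cis (c * t)) has_integral (cis (c * pi) / (\<i> * c) - cis (c * 0) / (\<i> * c))) {0..pi}"
    proof (rule fundamental_theorem_of_calculus)
      show "((\<lambda>t. cis (c * t) / (\<i> * c)) has_vector_derivative cis (c * t)) (at t within {0..pi})" for t
        unfolding cis_conv_exp using elim
        by (auto intro!: derivative_eq_intros has_vector_derivative_real_field simp: field_simps)
    qed simp
    then have "(\<integral>t. cis (c * t) \<partial>arc_measure) = (cis (c * pi) / (\<i> * c) - 1 / (\<i> * c)) /\<^sub>R pi"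
      by (subst integral_arc_measure_continuous) (auto intro!: continuous_intros dest: integral_unique)
    then have "norm (\<integral>t. cis (c * t) \<partial>arc_measure) = norm (cis (c * pi) / (\<i> * c) - 1 / (\<i> * c)) / pi"
      by (simp only: norm_scaleR) (simp add: divide_inverse_commute)
    also have "\<dots> \<le> (1 / c + 1 / c) / pi"
      using elim by (intro divide_right_mono order_trans[OF norm_triangle_ineq4])
        (auto simp: norm_divide norm_mult)
    finally show ?case
      by (simp add: mult.commute)
  qed
  show "((\<lambda>c. 2 / (pi * c)) \<longlongrightarrow> 0) at_top"
    by real_asymp
qed

lemma integral_poly_cos_cis_tendsto_0:
  "((\<lambda>c. \<integral>t. complex_of_real (poly q (cos t)) * cis (c * t) \<partial>arc_measure) \<longlongrightarrow> 0) at_top"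
proof (induction q rule: Chebyshev_T_induct)
  case (Chebyshev_T n)
  have product: "complex_of_real (poly (Chebyshev_T n) (cos t)) * cis (c * t)
      = (cis ((c + real n) * t) + cis ((c - real n) * t)) / 2" for c t
    by (simp add: poly_Chebyshev_T_cos complex_eq_iff cos_add sin_add cos_diff sin_diff algebra_simps)
  have int: "integrable arc_measure (\<lambda>t. cis (c * t))" for c
    by (intro integrable_arc_measure_continuous continuous_intros)
  have shift: "((\<lambda>c. \<integral>t. cis ((c + a) * t) \<partial>arc_measure) \<longlongrightarrow> 0) at_top" for a
    by (rule filterlim_compose[OF integral_cis_tendsto_0]) real_asymp
  have "((\<lambda>c. ((\<integral>t. cis ((c + real n) * t) \<partial>arc_measure) + (\<integral>t. cis ((c - real n) * t) \<partial>arc_measure)) / 2)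
      \<longlongrightarrow> (0 + 0) / 2) at_top"
    using shift[of "- real n"] by (intro tendsto_intros shift) simp_all
  then show ?case
    unfolding product using int by simp
next
  case (add q r)
  have "integrable arc_measure (\<lambda>t. complex_of_real (poly q (cos t)) * cis (c * t))" for c q
    by (intro integrable_arc_measure_continuous continuous_intros)
  then show ?case
    using tendsto_add[OF add.IH] by (simp add: distrib_right)
next
  case (smult a q)
  then show ?case
    using tendsto_mult_right_zero[of _ _ "complex_of_real a"] by (simp add: mult.assoc)
qed

theorem Riemann_Lebesgue:
  fixes f :: "real \<Rightarrow> complex"
  assumes "integrable arc_measure f"
  shows "((\<lambda>c. \<integral>t. f t * cis (c * t) \<partial>arc_measure) \<longlongrightarrow> 0) at_top"
  using assms
proof (induction f rule: integrable_induct)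
  case (base A a)
  then have [measurable]: "A \<in> sets borel"
    by simp
  obtain q where q_le: "\<And>k t. \<bar>poly (q k) (cos t)\<bar> \<le> 1 + 1"
    and q_lim: "AE t in arc_measure. (\<lambda>k. poly (q k) (cos t)) \<longlonglongrightarrow> indicator A t"
    by (rule bounded_borel_AE_limit_poly_cos[of "indicator A" 1]) auto
  show ?case
  proof (rule integral_mult_tendsto_0_dominated_limit
      [where s="\<lambda>k t. poly (q k) (cos t) *\<^sub>R a" and w="\<lambda>_. 2 * norm a"])
    show "AE t in arc_measure. (\<lambda>k. poly (q k) (cos t) *\<^sub>R a) \<longlonglongrightarrow> indicator A t *\<^sub>R a"
      using q_lim by eventually_elim (intro tendsto_intros)
    show "AE t in arc_measure. norm (poly (q k) (cos t) *\<^sub>R a) \<le> 2 * norm a" for k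
      using q_le[of k] by (auto intro!: AE_I2 mult_right_mono)
    show "((\<lambda>c. \<integral>t. poly (q k) (cos t) *\<^sub>R a * cis (c * t) \<partial>arc_measure) \<longlongrightarrow> 0) at_top" for k
      using tendsto_mult_right_zero[OF integral_poly_cos_cis_tendsto_0, of a "q k"]
      by (simp add: scaleR_conv_of_real mult_ac)
  qed auto
next
  case (add f g)
  then have "integrable arc_measure (\<lambda>t. f t * cis (c * t))"
      "integrable arc_measure (\<lambda>t. g t * cis (c * t))" for c
    by (auto intro: integrable_mult_bounded[where C=1])
  then show ?case
    using tendsto_add[OF add.IH] by (simp add: distrib_right)
next
  case (lim f s)
  show ?case
    by (rule integral_mult_tendsto_0_dominated_limit[where s=s and w="\<lambda>t. 2 * norm (f t)"])
      (use lim borel_measurable_integrable in auto)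
qed

section \<open>Equidistribution of oscillations\<close>

definition oscillation :: "(real \<Rightarrow> complex) \<Rightarrow> nat \<Rightarrow> real \<Rightarrow> real" where
  "oscillation f n t = Re (f t * cis (real n * t))"

lemma borel_measurable_oscillation [measurable]:
  assumes [measurable]: "f \<in> borel_measurable borel"
  shows "oscillation f n \<in> borel_measurable borel"
  unfolding oscillation_def[abs_def] by measurable

lemma abs_oscillation_le: "\<bar>oscillation f n t\<bar> \<le> norm (f t)"
  unfolding oscillation_def by (rule order_trans[OF abs_Re_le_cmod]) (simp add: norm_mult)

lemma integral_oscillation_tendsto_0:
  assumes f: "integrable arc_measure f" and "0 < m"
  shows "(\<lambda>n. \<integral>t. oscillation f (n * m) t \<partial>arc_measure) \<longlonglongrightarrow> 0"
proof -
  have int: "integrable arc_measure (\<lambda>t. f t * cis (real (n * m) * t))" for n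
    by (intro integrable_mult_bounded[where C=1] f) auto
  have "filterlim (\<lambda>n. real (n * m)) at_top sequentially"
    using \<open>0 < m\<close> by real_asymp
  from tendsto_Re[OF filterlim_compose[OF Riemann_Lebesgue[OF f] this]] show ?thesis
    unfolding oscillation_def using integral_Re[OF int] by simp
qed

lemma mean_square_oscillation_tendsto:
  assumes [measurable]: "f \<in> borel_measurable borel"
    and f2: "integrable arc_measure (\<lambda>t. (norm (f t))\<^sup>2)"
  shows "(\<lambda>n. \<integral>t. (oscillation f n t)\<^sup>2 \<partial>arc_measure) \<longlonglongrightarrow> (\<integral>t. (norm (f t))\<^sup>2 \<partial>arc_measure) / 2"
proof -
  have f_sq: "integrable arc_measure (\<lambda>t. (f t)\<^sup>2)"
    by (rule Bochner_Integration.integrable_bound[OF f2]) (auto simp: norm_power)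
  have square: "(oscillation f n t)\<^sup>2 = ((norm (f t))\<^sup>2 + oscillation (\<lambda>t. (f t)\<^sup>2) (n * 2) t) / 2" for n t
  proof -
    have "(Re z)\<^sup>2 = ((norm z)\<^sup>2 + Re (z\<^sup>2)) / 2" for z :: complex
      unfolding cmod_power2 by (simp add: power2_eq_square)
    from this[of "f t * cis (real n * t)"] show ?thesis
      by (simp add: oscillation_def norm_mult power_mult_distrib Complex.DeMoivre mult_ac
        del: times_complex.sel)
  qed
  have "integrable arc_measure (oscillation (\<lambda>t. (f t)\<^sup>2) (n * 2))" for n
    by (rule Bochner_Integration.integrable_bound[OF f2])
      (auto intro!: AE_I2 order_trans[OF abs_oscillation_le] simp: norm_power)
  then have "(\<integral>t. (oscillation f n t)\<^sup>2 \<partial>arc_measure)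
      = ((\<integral>t. (norm (f t))\<^sup>2 \<partial>arc_measure) + (\<integral>t. oscillation (\<lambda>t. (f t)\<^sup>2) (n * 2) t \<partial>arc_measure)) / 2" for n
    unfolding square using f2 by simp
  moreover have "(\<lambda>n. ((\<integral>t. (norm (f t))\<^sup>2 \<partial>arc_measure)
        + (\<integral>t. oscillation (\<lambda>t. (f t)\<^sup>2) (n * 2) t \<partial>arc_measure)) / 2)
      \<longlonglongrightarrow> ((\<integral>t. (norm (f t))\<^sup>2 \<partial>arc_measure) + 0) / 2"
    by (intro tendsto_intros integral_oscillation_tendsto_0 f_sq) simp_all
  ultimately show ?thesis
    by (simp only: add_0_right)
qed

lemma integral_cos_multiple_arc_measure:
  "(\<integral>t. cos (real m * t) \<partial>arc_measure) = (if m = 0 then 1 else 0)"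
proof (cases "m = 0")
  case False
  have "((\<lambda>t. cos (real m * t)) has_integral (sin (real m * pi) / real m - sin (real m * 0) / real m)) {0..pi}"
    using False
    by (intro fundamental_theorem_of_calculus)
      (auto intro!: derivative_eq_intros simp flip: has_real_derivative_iff_has_vector_derivative)
  then have "integral {0..pi} (\<lambda>t. cos (real m * t)) = 0"
    by (simp add: integral_unique sin_npi)
  with False show ?thesis
    by (subst integral_arc_measure_continuous) (auto intro!: continuous_intros)
qed simp

lemma unimodular_oscillation_equidistributed_poly:
  fixes f :: "real \<Rightarrow> real" and q :: "real poly"
  assumes [measurable]: "u \<in> borel_measurable borel" and u: "\<And>t. norm (u t) = 1"
    and f: "integrable arc_measure f"
  shows "(\<lambda>n. \<integral>t. f t * poly q (oscillation u n t) \<partial>arc_measure)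
    \<longlonglongrightarrow> (\<integral>t. f t \<partial>arc_measure) * (\<integral>t. poly q (cos t) \<partial>arc_measure)"
proof (induction q rule: Chebyshev_T_induct)
  case (Chebyshev_T m)
  show ?case
  proof (cases "m = 0")
    case False
    have "f t * poly (Chebyshev_T m) (oscillation u n t)
        = oscillation (\<lambda>t. complex_of_real (f t) * u t ^ m) (n * m) t" for n t
    proof -
      have "poly (Chebyshev_T m) (oscillation u n t) = Re ((u t * cis (real n * t)) ^ m)"
        unfolding oscillation_def by (rule poly_Chebyshev_T_Re) (simp add: norm_mult u)
      then show ?thesis
        by (simp add: oscillation_def power_mult_distrib Complex.DeMoivre mult_ac)
    qed
    moreover have "integrable arc_measure (\<lambda>t. complex_of_real (f t) * u t ^ m)"
      using f by (intro integrable_mult_bounded[where C=1]) (auto simp: norm_power u)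
    ultimately show ?thesis
      using False by (simp add: integral_oscillation_tendsto_0 poly_Chebyshev_T_cos
          integral_cos_multiple_arc_measure)
  qed simp
next
  case (add q r)
  have "oscillation u n t \<in> {-1..1}" for n t
    using abs_oscillation_le[of u n t] by (simp add: u abs_le_iff)
  then have "integrable arc_measure (\<lambda>t. f t * poly q (oscillation u n t))" for q n
    by (intro integrable_mult_continuous_compose f continuous_intros) auto
  then show ?case
    using tendsto_add[OF add.IH] integrable_poly_cos by (simp add: distrib_left)
next
  case (smult c q)
  then show ?case
    using tendsto_mult_left[of _ _ _ c] by (simp add: mult.left_commute)
qed

lemma uniform_limit_integral_mult_compose:
  fixes f :: "'a \<Rightarrow> real" and \<phi> :: "real \<Rightarrow> real"
  assumes f: "integrable M f"
    and cont: "\<And>k. continuous_on UNIV (\<psi> k)" "continuous_on UNIV \<phi>"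
    and lim: "uniform_limit {a..b} \<psi> \<phi> sequentially"
    and [measurable]: "\<And>n. x n \<in> borel_measurable M" and x: "\<And>n t. x n t \<in> {a..b}"
  shows "uniform_limit UNIV (\<lambda>k n. \<integral>t. f t * \<psi> k (x n t) \<partial>M) (\<lambda>n. \<integral>t. f t * \<phi> (x n t) \<partial>M) sequentially"
proof (rule uniform_limitI)
  fix e :: real
  assume "0 < e"
  define d where "d = e / ((\<integral>t. \<bar>f t\<bar> \<partial>M) + 1)"
  have "0 < d" and integral_f_less: "(\<integral>t. \<bar>f t\<bar> \<partial>M) * d < e"
    using \<open>0 < e\<close> by (auto simp: d_def divide_simps mult_less_cancel_right add_nonneg_pos)
  have int: "integrable M (\<lambda>t. f t * \<theta> (x n t))" if "continuous_on UNIV \<theta>" for \<theta> n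
    by (rule integrable_mult_continuous_compose[OF f that _ x]) simp
  show "\<forall>\<^sub>F k in sequentially. \<forall>n\<in>UNIV. dist (\<integral>t. f t * \<psi> k (x n t) \<partial>M) (\<integral>t. f t * \<phi> (x n t) \<partial>M) < e"
    using uniform_limitD[OF lim \<open>0 < d\<close>]
  proof (eventually_elim, intro ballI)
    fix k n
    assume k: "\<forall>y\<in>{a..b}. dist (\<psi> k y) (\<phi> y) < d"
    have "dist (\<integral>t. f t * \<psi> k (x n t) \<partial>M) (\<integral>t. f t * \<phi> (x n t) \<partial>M)
        = \<bar>\<integral>t. f t * \<psi> k (x n t) - f t * \<phi> (x n t) \<partial>M\<bar>"
      using int cont by (simp add: dist_real_def)
    also have "\<dots> \<le> (\<integral>t. \<bar>f t * \<psi> k (x n t) - f t * \<phi> (x n t)\<bar> \<partial>M)"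
      by (rule integral_abs_bound)
    also have "\<dots> \<le> (\<integral>t. \<bar>f t\<bar> * d \<partial>M)"
    proof (rule integral_mono)
      show "\<bar>f t * \<psi> k (x n t) - f t * \<phi> (x n t)\<bar> \<le> \<bar>f t\<bar> * d" for t
        using k x[of n t] unfolding right_diff_distrib[symmetric] abs_mult dist_real_def
        by (intro mult_left_mono) (auto intro: less_imp_le)
    qed (use f int cont in auto)
    also have "\<dots> < e"
      using integral_f_less by simp
    finally show "dist (\<integral>t. f t * \<psi> k (x n t) \<partial>M) (\<integral>t. f t * \<phi> (x n t) \<partial>M) < e" .
  qed
qed

theorem unimodular_oscillation_equidistributed:
  fixes f \<phi> :: "real \<Rightarrow> real"
  assumes [measurable]: "u \<in> borel_measurable borel" and u: "\<And>t. norm (u t) = 1"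
    and f: "integrable arc_measure f" and \<phi>: "continuous_on UNIV \<phi>"
  shows "(\<lambda>n. \<integral>t. f t * \<phi> (oscillation u n t) \<partial>arc_measure)
    \<longlonglongrightarrow> (\<integral>t. f t \<partial>arc_measure) * (\<integral>t. \<phi> (cos t) \<partial>arc_measure)"
proof -
  have [measurable]: "\<phi> \<in> borel_measurable borel"
    by (rule borel_measurable_continuous_onI[OF \<phi>])
  have osc: "oscillation u n t \<in> {-1..1}" for n t
    using abs_oscillation_le[of u n t] by (simp add: u abs_le_iff)
  obtain q where q: "uniform_limit {-1..1} (\<lambda>k. poly (q k)) \<phi> sequentially"
    using Weierstrass_poly_uniform_limit[OF continuous_on_subset[OF \<phi> subset_UNIV]] by blast
  show ?thesis
  proof (rule swap_uniform_limit')
    show "\<forall>\<^sub>F k in sequentially. (\<lambda>n. \<integral>t. f t * poly (q k) (oscillation u n t) \<partial>arc_measure)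
        \<longlonglongrightarrow> (\<integral>t. f t \<partial>arc_measure) * (\<integral>t. poly (q k) (cos t) \<partial>arc_measure)"
      by (intro always_eventually allI unimodular_oscillation_equidistributed_poly assms)
    show "uniform_limit UNIV (\<lambda>k n. \<integral>t. f t * poly (q k) (oscillation u n t) \<partial>arc_measure)
        (\<lambda>n. \<integral>t. f t * \<phi> (oscillation u n t) \<partial>arc_measure) sequentially"
      by (rule uniform_limit_integral_mult_compose[OF f _ \<phi> q _ osc]) (auto intro!: continuous_intros)
    have "uniform_limit UNIV (\<lambda>k (_::unit). \<integral>t. 1 * poly (q k) (cos t) \<partial>arc_measure)
        (\<lambda>_. \<integral>t. 1 * \<phi> (cos t) \<partial>arc_measure) sequentially"
      by (rule uniform_limit_integral_mult_compose[OF _ _ \<phi> q]) (auto intro!: continuous_intros)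
    then have "(\<lambda>k. \<integral>t. poly (q k) (cos t) \<partial>arc_measure) \<longlonglongrightarrow> (\<integral>t. \<phi> (cos t) \<partial>arc_measure)"
      using tendsto_uniform_limitI by fastforce
    then show "(\<lambda>k. (\<integral>t. f t \<partial>arc_measure) * (\<integral>t. poly (q k) (cos t) \<partial>arc_measure))
        \<longlonglongrightarrow> (\<integral>t. f t \<partial>arc_measure) * (\<integral>t. \<phi> (cos t) \<partial>arc_measure)"
      by (rule tendsto_mult_left)
  qed auto
qed

section \<open>Circle means of holomorphic functions\<close>

lemma holomorphic_circle_mean:
  fixes f :: "complex \<Rightarrow> complex"
  assumes "continuous_on (cball 0 1) f" "f holomorphic_on ball 0 1"
  shows "((\<lambda>t. f (cis t)) has_integral 2 * pi * f 0) {0..2 * pi}"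
proof -
  have "((\<lambda>z. f z / (z - 0)) has_contour_integral (2 * pi * \<i>) * f 0) (circlepath 0 1)"
    using Cauchy_integral_circlepath[OF assms, of 0] by simp
  then have "((\<lambda>x. (2 * pi * \<i>) * f (cis (2 * pi * x))) has_integral (2 * pi * \<i>) * f 0) {0..1}"
    unfolding has_contour_integral_def
    by (rule has_integral_eq[rotated])
      (simp add: vector_derivative_circlepath01, simp add: circlepath cis_conv_exp mult_ac)
  then have "((\<lambda>x. inverse (2 * pi * \<i>) * ((2 * pi * \<i>) * f (cis (2 * pi * x))))
      has_integral inverse (2 * pi * \<i>) * ((2 * pi * \<i>) * f 0)) {0..1}"
    by (rule has_integral_mult_right)
  then have "((\<lambda>x. f (cis (2 * pi * x))) has_integral f 0) (cbox 0 1)"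
    by (simp add: field_simps)
  from has_integral_affinity'[OF this, of "1 / (2 * pi)" 0] show ?thesis
    by (simp add: scaleR_conv_of_real)
qed

lemma continuous_on_compose_cis:
  fixes f :: "complex \<Rightarrow> complex"
  assumes "continuous_on (cball 0 1) f"
  shows "continuous_on UNIV (\<lambda>t. f (cis (c * t)))"
  by (rule continuous_on_compose2[OF assms]) (auto intro!: continuous_intros)

lemma integral_holomorphic_cis_double:
  fixes f :: "complex \<Rightarrow> complex"
  assumes f: "continuous_on (cball 0 1) f" "f holomorphic_on ball 0 1"
  shows "(\<integral>t. f (cis (2 * t)) \<partial>arc_measure) = f 0"
proof -
  have "((\<lambda>t. f (cis t)) has_integral 2 * pi * f 0) (cbox 0 (2 * pi))"
    using holomorphic_circle_mean[OF f] by simp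
  from has_integral_affinity'[OF this, of 2 0] have "integral {0..pi} (\<lambda>t. f (cis (2 * t))) = pi * f 0"
    by (intro integral_unique) (simp add: scaleR_conv_of_real)
  then show ?thesis
    by (simp add: integral_arc_measure_continuous[OF continuous_on_compose_cis[OF f(1)]] scaleR_conv_of_real)
qed

lemma integral_holomorphic_cis_symmetric:
  fixes f :: "complex \<Rightarrow> complex"
  assumes f: "continuous_on (cball 0 1) f" "f holomorphic_on ball 0 1"
  shows "(\<integral>t. f (cis t) + f (cis (- t)) \<partial>arc_measure) = 2 * f 0"
proof -
  have cont: "continuous_on UNIV (\<lambda>t. f (cis t))" "continuous_on UNIV (\<lambda>t. f (cis (- t)))"
    using continuous_on_compose_cis[OF f(1), of 1] continuous_on_compose_cis[OF f(1), of "- 1"] by auto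
  have "((\<lambda>t. f (cis t)) has_integral integral {pi..2 * pi} (\<lambda>t. f (cis t))) (cbox pi (2 * pi))"
    unfolding cbox_interval
    by (intro integrable_integral integrable_continuous_real continuous_on_subset[OF cont(1)]) auto
  from has_integral_affinity[OF this, of "- 1" "2 * pi"]
  have "((\<lambda>t. f (cis (2 * pi - t))) has_integral integral {pi..2 * pi} (\<lambda>t. f (cis t))) {0..pi}"
    by simp
  moreover have "cis (2 * pi - t) = cis (- t)" for t
    by (simp add: complex_eq_iff cos_diff sin_diff)
  ultimately have upper: "integral {0..pi} (\<lambda>t. f (cis (- t))) = integral {pi..2 * pi} (\<lambda>t. f (cis t))"
    by (simp add: integral_unique)
  have "integral {0..pi} (\<lambda>t. f (cis t)) + integral {pi..2 * pi} (\<lambda>t. f (cis t))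
      = integral {0..2 * pi} (\<lambda>t. f (cis t))"
    by (intro Henstock_Kurzweil_Integration.integral_combine integrable_continuous_real
        continuous_on_subset[OF cont(1)]) auto
  also have "\<dots> = 2 * pi * f 0"
    using holomorphic_circle_mean[OF f] by (rule integral_unique)
  finally have "integral {0..pi} (\<lambda>t. f (cis t)) + integral {0..pi} (\<lambda>t. f (cis (- t))) = 2 * pi * f 0"
    by (simp add: upper)
  then show ?thesis
    using cont
    by (simp add: integrable_arc_measure_continuous integral_arc_measure_continuous scaleR_conv_of_real
        flip: distrib_left)
qed

lemma integral_ln_norm_holomorphic_symmetric:
  assumes f: "f holomorphic_on ball 0 R" and nonzero: "\<And>z. z \<in> ball 0 R \<Longrightarrow> f z \<noteq> 0" and R: "1 < R"
  shows "(\<integral>t. ln (norm (f (cis t))) + ln (norm (f (cis (- t)))) \<partial>arc_measure) = 2 * ln (norm (f 0))"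
proof -
  obtain g where g: "g holomorphic_on ball 0 R" and exp_g: "\<And>z. z \<in> ball 0 R \<Longrightarrow> exp (g z) = f z"
    by (rule holomorphic_logarithm_exists[OF convex_ball open_ball f nonzero, of 0]) (use R in auto)
  have ln_f: "ln (norm (f z)) = Re (g z)" if "norm z \<le> 1" for z
    using that R by (simp add: exp_g[symmetric])
  have g_disc: "continuous_on (cball 0 1) g" "g holomorphic_on ball 0 1"
    using R by (auto intro!: holomorphic_on_imp_continuous_on holomorphic_on_subset[OF g])
  have "integrable arc_measure (\<lambda>t. g (cis (1 * t)) + g (cis (- 1 * t)))"
    by (intro Bochner_Integration.integrable_add integrable_arc_measure_continuous
        continuous_on_compose_cis g_disc)
  then have "(\<integral>t. Re (g (cis t) + g (cis (- t))) \<partial>arc_measure)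
      = Re (\<integral>t. g (cis t) + g (cis (- t)) \<partial>arc_measure)"
    by (intro integral_Re) simp
  then show ?thesis
    by (simp add: ln_f integral_holomorphic_cis_symmetric[OF g_disc])
qed

section \<open>Evaluation of real polynomials at complex points\<close>

definition complex_eval :: "real poly \<Rightarrow> complex \<Rightarrow> complex" where
  "complex_eval h z = poly (map_poly complex_of_real h) z"

lemma complex_eval_0 [simp]: "complex_eval 0 z = 0"
  by (simp add: complex_eval_def)

lemma complex_eval_pCons [simp]: "complex_eval (pCons a h) z = complex_of_real a + z * complex_eval h z"
  by (simp add: complex_eval_def map_poly_pCons)

lemma complex_eval_1 [simp]: "complex_eval 1 z = 1"
  by (simp add: one_pCons)

lemma complex_eval_add [simp]: "complex_eval (h + k) z = complex_eval h z + complex_eval k z"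
  by (induction h k rule: poly_induct2) (simp_all add: algebra_simps)

lemma complex_eval_smult [simp]: "complex_eval (smult c h) z = complex_of_real c * complex_eval h z"
  by (induction h) (simp_all add: algebra_simps)

lemma complex_eval_diff [simp]: "complex_eval (h - k) z = complex_eval h z - complex_eval k z"
  using complex_eval_add[of "h - k" k z] by (simp del: complex_eval_add)

lemma complex_eval_mult [simp]: "complex_eval (h * k) z = complex_eval h z * complex_eval k z"
  by (induction h) (simp_all add: algebra_simps)

lemma complex_eval_power [simp]: "complex_eval (h ^ n) z = complex_eval h z ^ n"
  by (induction n) simp_all

lemma complex_eval_sum [simp]: "complex_eval (\<Sum>i\<in>A. h i) z = (\<Sum>i\<in>A. complex_eval (h i) z)"
  by (induction A rule: infinite_finite_induct) simp_all

lemma complex_eval_monom [simp]: "complex_eval (monom a n) z = complex_of_real a * z ^ n"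
  by (simp add: complex_eval_def map_poly_monom poly_monom)

lemma complex_eval_altdef: "complex_eval h z = (\<Sum>i\<le>degree h. complex_of_real (coeff h i) * z ^ i)"
  by (subst poly_as_sum_of_monoms[symmetric, of h]) (simp only: complex_eval_sum complex_eval_monom)

lemma complex_eval_at_0: "complex_eval h 0 = complex_of_real (coeff h 0)"
  by (cases h) simp

lemma complex_eval_cnj: "complex_eval h (cnj z) = cnj (complex_eval h z)"
  by (induction h) simp_all

lemma continuous_on_complex_eval [continuous_intros]:
  assumes "continuous_on S f"
  shows "continuous_on S (\<lambda>x. complex_eval h (f x))"
  unfolding complex_eval_def using assms by (intro continuous_intros)

lemma borel_measurable_complex_eval [measurable]: "complex_eval h \<in> borel_measurable borel"
  by (intro borel_measurable_continuous_onI continuous_intros)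

lemma complex_eval_cis_bounded: obtains B where "\<And>t. norm (complex_eval h (cis t)) \<le> B"
proof -
  have "continuous_on (sphere 0 1) (complex_eval h)"
    by (intro continuous_intros)
  then obtain B where "\<And>z. z \<in> sphere 0 1 \<Longrightarrow> norm (complex_eval h z) \<le> B"
    using continuous_on_compact_bound[OF compact_sphere] by blast
  then show ?thesis
    by (intro that[of B]) simp
qed

section \<open>Szego's lower bound\<close>

lemma norm_one_minus_cnj_mult:
  fixes a z :: complex
  assumes "norm z = 1"
  shows "norm (1 - cnj a * z) = norm (z - a)"
proof -
  have "z * cnj (z - a) = 1 - cnj a * z"
    using complex_norm_square[of z] assms by (simp add: algebra_simps)
  then show ?thesis
    using assms by (metis complex_mod_cnj mult_1 norm_mult)
qed

lemma one_minus_cnj_mult_nonzero: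
  fixes a z :: complex
  assumes "norm a < 1" "norm z < 1"
  shows "1 - cnj a * z \<noteq> 0"
proof -
  have "norm (cnj a * z) < 1"
    using mult_strict_mono'[OF assms] by (simp add: norm_mult)
  then show ?thesis
    by auto
qed

text \<open>A zero \<open>a\<close> in the open disc is reflected to \<open>1 / cnj a\<close>.\<close>
lemma exists_poly_zero_free_disc:
  fixes h :: "complex poly"
  assumes "poly h 0 \<noteq> 0"
  shows "\<exists>k. poly k 0 = poly h 0 \<and> (\<forall>z. norm z < 1 \<longrightarrow> poly k z \<noteq> 0) \<and>
    (\<forall>z. norm z = 1 \<longrightarrow> norm (poly k z) \<le> norm (poly h z))"
  using assms
proof (induction "degree h" arbitrary: h rule: less_induct)
  case less
  show ?case
  proof (cases "\<exists>a. norm a < 1 \<and> poly h a = 0")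
    case True
    then obtain a where a: "norm a < 1" "poly h a = 0"
      by blast
    then obtain h' where h': "h = [:- a, 1:] * h'"
      by (auto simp: poly_eq_0_iff_dvd elim: dvdE)
    then have "poly h' 0 \<noteq> 0"
      using less.prems by auto
    moreover from this have "degree h' < degree h"
      unfolding h' by (subst degree_mult_eq) auto
    ultimately obtain k where k: "poly k 0 = poly h' 0" "\<And>z. norm z < 1 \<Longrightarrow> poly k z \<noteq> 0"
        "\<And>z. norm z = 1 \<Longrightarrow> norm (poly k z) \<le> norm (poly h' z)"
      using less.hyps by blast
    define k' where "k' = smult (- a) ([:1, - cnj a:] * k)"
    have k'_eq: "poly k' z = - a * ((1 - cnj a * z) * poly k z)" for z
      by (simp add: k'_def algebra_simps)
    have "poly k' 0 = poly h 0"
      by (simp add: k'_eq h' k)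
    moreover have "poly k' z \<noteq> 0" if "norm z < 1" for z
      using k(2)[OF that] one_minus_cnj_mult_nonzero[OF a(1) that] a(2) less.prems by (auto simp: k'_eq)
    moreover have "norm (poly k' z) \<le> norm (poly h z)" if "norm z = 1" for z
    proof -
      have "norm (poly k' z) = norm a * (norm (z - a) * norm (poly k z))"
        by (simp add: k'_eq norm_mult norm_one_minus_cnj_mult[OF that])
      also have "\<dots> \<le> 1 * (norm (z - a) * norm (poly h' z))"
        using a(1) k(3)[OF that] by (intro mult_mono) auto
      also have "\<dots> = norm (poly h z)"
        by (simp add: h' norm_mult[symmetric] algebra_simps)
      finally show ?thesis .
    qed
    ultimately show ?thesis
      by blast
  qed blast
qed

lemma (in prob_space) exp_expectation_ln_le:
  fixes X :: "'a \<Rightarrow> real"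
  assumes "integrable M X" "integrable M (\<lambda>x. ln (X x))" and pos: "AE x in M. 0 < X x"
  shows "exp (expectation (\<lambda>x. ln (X x))) \<le> expectation X"
proof -
  have exp_ln_eq: "AE x in M. exp (ln (X x)) = X x"
    using pos by eventually_elim simp
  have "exp (expectation (\<lambda>x. ln (X x))) \<le> expectation (\<lambda>x. exp (ln (X x)))"
    using assms exp_ln_eq
    by (intro jensens_inequality[where I=UNIV] exp_convex) (auto intro: integrable_cong_AE_imp)
  also have "\<dots> = expectation X"
    using assms exp_ln_eq by (intro integral_cong_AE) auto
  finally show ?thesis .
qed

lemma exp_integral_ln_le_weighted:
  fixes v W :: "real \<Rightarrow> real"
  assumes v: "integrable arc_measure v" "integrable arc_measure (\<lambda>t. ln (v t))" "AE t in arc_measure. 0 < v t"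
    and W: "continuous_on UNIV W" "\<And>t. 0 < W t" "(\<integral>t. ln (W t) \<partial>arc_measure) = 0"
    and Wv: "integrable arc_measure (\<lambda>t. W t * v t)"
  shows "exp (\<integral>t. ln (v t) \<partial>arc_measure) \<le> (\<integral>t. W t * v t \<partial>arc_measure)"
proof -
  have [measurable]: "v \<in> borel_measurable borel" "W \<in> borel_measurable borel"
    using borel_measurable_integrable[OF v(1)] borel_measurable_continuous_onI[OF W(1)] by simp_all
  have ln_W: "integrable arc_measure (\<lambda>t. ln (W t))"
    using W by (intro integrable_arc_measure_continuous continuous_intros) (auto simp: less_imp_neq[symmetric])
  have ln_Wv: "AE t in arc_measure. ln (W t) + ln (v t) = ln (W t * v t)"
    using v(3) by eventually_elim (use W(2) in \<open>simp add: ln_mult_pos\<close>)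
  have "(\<integral>t. ln (v t) \<partial>arc_measure) = (\<integral>t. ln (W t) + ln (v t) \<partial>arc_measure)"
    using ln_W v(2) W(3) by simp
  also have "\<dots> = (\<integral>t. ln (W t * v t) \<partial>arc_measure)"
    by (rule integral_cong_AE[OF _ _ ln_Wv]) auto
  also have "exp \<dots> \<le> (\<integral>t. W t * v t \<partial>arc_measure)"
  proof (rule arc.exp_expectation_ln_le[OF Wv])
    show "integrable arc_measure (\<lambda>t. ln (W t * v t))"
      by (rule integrable_cong_AE_imp[OF Bochner_Integration.integrable_add[OF ln_W v(2)] _ ln_Wv]) simp
    show "AE t in arc_measure. 0 < W t * v t"
      using v(3) by eventually_elim (use W(2) in simp)
  qed
  finally show ?thesis .
qed

text \<open>The product over \<open>t\<close> and \<open>- t\<close> makes up for \<open>k\<close> not having real coefficients.\<close>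
definition symmetric_modulus :: "complex poly \<Rightarrow> real \<Rightarrow> real \<Rightarrow> real" where
  "symmetric_modulus k r t = norm (poly k (r * cis t)) * norm (poly k (r * cis (- t)))"

lemma continuous_on_symmetric_modulus: "continuous_on UNIV (symmetric_modulus k r)"
  unfolding symmetric_modulus_def by (intro continuous_intros)

lemma borel_measurable_symmetric_modulus [measurable]: "symmetric_modulus k r \<in> borel_measurable borel"
  by (rule borel_measurable_continuous_onI[OF continuous_on_symmetric_modulus])

lemma symmetric_modulus_bounded:
  obtains B where "\<And>r t. 0 \<le> r \<Longrightarrow> r \<le> 1 \<Longrightarrow> \<bar>symmetric_modulus k r t\<bar> \<le> B"
proof -
  have "continuous_on (cball 0 1) (poly k)"
    by (intro continuous_intros)
  then obtain B where B: "0 \<le> B" "\<And>z. z \<in> cball 0 1 \<Longrightarrow> norm (poly k z) \<le> B"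
    using continuous_on_compact_bound[OF compact_cball] by blast
  show ?thesis
  proof
    show "\<bar>symmetric_modulus k r t\<bar> \<le> B * B" if "0 \<le> r" "r \<le> 1" for r t
      unfolding symmetric_modulus_def abs_mult abs_norm_cancel
      using that B by (intro mult_mono) (auto simp: norm_mult)
  qed
qed

lemma symmetric_modulus_mult_integrable:
  assumes "integrable arc_measure v" "0 \<le> r" "r \<le> 1"
  shows "integrable arc_measure (\<lambda>t. symmetric_modulus k r t * v t)"
proof -
  obtain B where "\<And>t. \<bar>symmetric_modulus k r t\<bar> \<le> B"
    using symmetric_modulus_bounded[of k] assms(2,3) by metis
  then show ?thesis
    using integrable_mult_bounded[OF assms(1), of "symmetric_modulus k r" B] by (simp add: mult.commute)
qed

lemma
  assumes k: "poly k 0 = 1" "\<And>z. norm z < 1 \<Longrightarrow> poly k z \<noteq> 0" and r: "0 < r" "r < 1"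
  shows symmetric_modulus_pos: "0 < symmetric_modulus k r t"
    and integral_ln_symmetric_modulus: "(\<integral>t. ln (symmetric_modulus k r t) \<partial>arc_measure) = 0"
proof -
  have nonzero: "poly k (r * z) \<noteq> 0" if "norm z < 1 / r" for z :: complex
    using that r by (intro k(2)) (simp add: norm_mult pos_less_divide_eq mult.commute)
  have R: "1 < 1 / r"
    using r by simp
  have circle: "poly k (r * cis t) \<noteq> 0" for t
    using R by (intro nonzero) simp
  then show "0 < symmetric_modulus k r t"
    by (simp add: symmetric_modulus_def)
  have "(\<lambda>z. poly k (r * z)) holomorphic_on ball 0 (1 / r)"
    by (intro holomorphic_intros)
  then have "(\<integral>t. ln (norm (poly k (r * cis t))) + ln (norm (poly k (r * cis (- t)))) \<partial>arc_measure) = 0"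
    using nonzero R by (subst integral_ln_norm_holomorphic_symmetric[where R="1 / r"]) (auto simp: k(1))
  then show "(\<integral>t. ln (symmetric_modulus k r t) \<partial>arc_measure) = 0"
    by (simp add: symmetric_modulus_def ln_mult_pos circle)
qed

lemma exp_integral_ln_le_zero_free:
  fixes v :: "real \<Rightarrow> real"
  assumes v: "integrable arc_measure v" "integrable arc_measure (\<lambda>t. ln (v t))" "AE t in arc_measure. 0 < v t"
    and k: "poly k 0 = 1" "\<And>z. norm z < 1 \<Longrightarrow> poly k z \<noteq> 0"
  shows "exp (\<integral>t. ln (v t) \<partial>arc_measure) \<le> (\<integral>t. symmetric_modulus k 1 t * v t \<partial>arc_measure)"
proof (rule LIMSEQ_le_const)
  define r where "r n = 1 - 1 / real (n + 2)" for n
  have r: "0 < r n" "r n < 1" for n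
    by (auto simp: r_def)
  obtain B where B: "\<And>r t. 0 \<le> r \<Longrightarrow> r \<le> 1 \<Longrightarrow> \<bar>symmetric_modulus k r t\<bar> \<le> B"
    using symmetric_modulus_bounded by blast
  show "(\<lambda>n. \<integral>t. symmetric_modulus k (r n) t * v t \<partial>arc_measure)
      \<longlonglongrightarrow> (\<integral>t. symmetric_modulus k 1 t * v t \<partial>arc_measure)"
  proof (rule integral_dominated_convergence[where w="\<lambda>t. B * \<bar>v t\<bar>"])
    have "r \<longlonglongrightarrow> 1"
      unfolding r_def by real_asymp
    then have "(\<lambda>n. symmetric_modulus k (r n) t) \<longlonglongrightarrow> symmetric_modulus k 1 t" for t
      unfolding symmetric_modulus_def by (intro tendsto_intros) auto
    then show "AE t in arc_measure. (\<lambda>n. symmetric_modulus k (r n) t * v t) \<longlonglongrightarrow> symmetric_modulus k 1 t * v t"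
      by (intro AE_I2 tendsto_intros)
    show "AE t in arc_measure. norm (symmetric_modulus k (r n) t * v t) \<le> B * \<bar>v t\<bar>" for n
      using B r[of n] by (intro AE_I2) (auto simp: abs_mult intro!: mult_right_mono)
  qed (use v borel_measurable_integrable[OF v(1)] in auto)
  have "exp (\<integral>t. ln (v t) \<partial>arc_measure) \<le> (\<integral>t. symmetric_modulus k (r n) t * v t \<partial>arc_measure)" for n
    using r[of n] by (intro exp_integral_ln_le_weighted v continuous_on_symmetric_modulus
        symmetric_modulus_pos integral_ln_symmetric_modulus k symmetric_modulus_mult_integrable) auto
  then show "\<exists>N. \<forall>n\<ge>N. exp (\<integral>t. ln (v t) \<partial>arc_measure) \<le> (\<integral>t. symmetric_modulus k (r n) t * v t \<partial>arc_measure)"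
    by blast
qed

theorem Szego_lower_bound:
  fixes v :: "real \<Rightarrow> real"
  assumes v: "integrable arc_measure v" "integrable arc_measure (\<lambda>t. ln (v t))" "AE t in arc_measure. 0 < v t"
    and h: "coeff h 0 = 1"
  shows "exp (\<integral>t. ln (v t) \<partial>arc_measure) \<le> (\<integral>t. (norm (complex_eval h (cis t)))\<^sup>2 * v t \<partial>arc_measure)"
proof -
  have "complex_eval h 0 = 1"
    by (simp add: complex_eval_at_0 h)
  then obtain k where k: "poly k 0 = 1" "\<And>z. norm z < 1 \<Longrightarrow> poly k z \<noteq> 0"
      "\<And>z. norm z = 1 \<Longrightarrow> norm (poly k z) \<le> norm (complex_eval h z)"
    unfolding complex_eval_def using exists_poly_zero_free_disc[of "map_poly complex_of_real h"] by auto
  have k_le: "symmetric_modulus k 1 t \<le> (norm (complex_eval h (cis t)))\<^sup>2" for t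
  proof -
    have "symmetric_modulus k 1 t \<le> norm (complex_eval h (cis t)) * norm (complex_eval h (cis (- t)))"
      unfolding symmetric_modulus_def by (intro mult_mono) (auto intro: k(3))
    then show ?thesis
      by (simp add: power2_eq_square complex_eval_cnj flip: cis_cnj)
  qed
  have [measurable]: "v \<in> borel_measurable borel"
    using borel_measurable_integrable[OF v(1)] by simp
  obtain B where B: "\<And>t. norm (complex_eval h (cis t)) \<le> B"
    using complex_eval_cis_bounded by blast
  have hv: "integrable arc_measure (\<lambda>t. (norm (complex_eval h (cis t)))\<^sup>2 * v t)"
    using integrable_mult_bounded[OF v(1), of "\<lambda>t. (norm (complex_eval h (cis t)))\<^sup>2" "B\<^sup>2"] B
    by (simp add: mult.commute power_mono)
  have kv_le: "AE t in arc_measure. symmetric_modulus k 1 t * v t \<le> (norm (complex_eval h (cis t)))\<^sup>2 * v t"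
    using v(3) by eventually_elim (use k_le in \<open>auto intro!: mult_right_mono\<close>)
  have "exp (\<integral>t. ln (v t) \<partial>arc_measure) \<le> (\<integral>t. symmetric_modulus k 1 t * v t \<partial>arc_measure)"
    by (rule exp_integral_ln_le_zero_free[OF v k(1,2)])
  also have "\<dots> \<le> (\<integral>t. (norm (complex_eval h (cis t)))\<^sup>2 * v t \<partial>arc_measure)"
    using hv kv_le v(1) by (intro integral_mono_AE symmetric_modulus_mult_integrable) auto
  finally show ?thesis .
qed

section \<open>Rapidly convergent sequences in \<open>L\<^sup>2\<close>\<close>

lemma power2_sum_le_weighted:
  fixes x :: "nat \<Rightarrow> real"
  shows "(\<Sum>j<k. x j)\<^sup>2 \<le> 2 * (\<Sum>j<k. 2 ^ j * (x j)\<^sup>2)"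
proof -
  have "(\<Sum>j<k. x j)\<^sup>2 = (\<Sum>j<k. sqrt ((1/2) ^ j) * (sqrt (2 ^ j) * x j))\<^sup>2"
    by (simp add: mult.assoc[symmetric] real_sqrt_mult[symmetric] power_mult_distrib[symmetric])
  also have "\<dots> \<le> (\<Sum>j<k. (sqrt ((1/2) ^ j))\<^sup>2) * (\<Sum>j<k. (sqrt (2 ^ j) * x j)\<^sup>2)"
    by (rule Cauchy_Schwarz_ineq_sum)
  also have "\<dots> = (\<Sum>j<k. (1/2) ^ j) * (\<Sum>j<k. 2 ^ j * (x j)\<^sup>2)"
    by (simp add: power_mult_distrib)
  also have "\<dots> \<le> 2 * (\<Sum>j<k. 2 ^ j * (x j)\<^sup>2)"
    by (intro mult_right_mono sum_nonneg) (auto simp: geometric_sum)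
  finally show ?thesis .
qed

lemma
  fixes x :: "nat \<Rightarrow> 'a::banach"
  assumes summable: "summable (\<lambda>k. 2 ^ k * (norm (x (Suc k) - x k))\<^sup>2)"
  shows convergent_if_weighted_squares_summable: "convergent x"
    and power2_norm_le_weighted_squares:
      "(norm (x k))\<^sup>2 \<le> 2 * (norm (x 0))\<^sup>2 + 4 * (\<Sum>j. 2 ^ j * (norm (x (Suc j) - x j))\<^sup>2)"
proof -
  define d where "d k = x (Suc k) - x k" for k
  define S where "S = (\<Sum>j. 2 ^ j * (norm (d j))\<^sup>2)"
  have telescope: "x k = x 0 + (\<Sum>j<k. d j)" for k
    by (simp add: d_def sum_lessThan_telescope)
  have sum_norm_sq: "(\<Sum>j<k. norm (d j))\<^sup>2 \<le> 2 * S" for k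
  proof -
    have "(\<Sum>j<k. 2 ^ j * (norm (d j))\<^sup>2) \<le> S"
      unfolding S_def d_def using summable by (intro sum_le_suminf) auto
    then show ?thesis
      using power2_sum_le_weighted[of "\<lambda>j. norm (d j)" k] by linarith
  qed
  then have "summable (\<lambda>k. norm (d k))"
    by (intro summableI_nonneg_bounded[where x="sqrt (2 * S)"]) (auto intro: real_le_rsqrt)
  then have "(\<lambda>k. x 0 + (\<Sum>j<k. d j)) \<longlonglongrightarrow> x 0 + suminf d"
    by (intro tendsto_intros summable_LIMSEQ) (rule summable_norm_cancel)
  then show "convergent x"
    unfolding telescope[symmetric] by (rule convergentI)
  have "(norm (x k))\<^sup>2 \<le> (norm (x 0) + (\<Sum>j<k. norm (d j)))\<^sup>2"
    unfolding telescope[of k]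
    by (intro power_mono order_trans[OF norm_triangle_ineq] add_left_mono norm_sum) auto
  also have "\<dots> \<le> 2 * (norm (x 0))\<^sup>2 + 2 * (\<Sum>j<k. norm (d j))\<^sup>2"
    using sum_squares_bound[of "norm (x 0)" "\<Sum>j<k. norm (d j)"] by (simp add: power2_sum)
  also have "\<dots> \<le> 2 * (norm (x 0))\<^sup>2 + 4 * S"
    using sum_norm_sq[of k] by simp
  finally show "(norm (x k))\<^sup>2 \<le> 2 * (norm (x 0))\<^sup>2 + 4 * (\<Sum>j. 2 ^ j * (norm (x (Suc j) - x j))\<^sup>2)"
    by (simp add: S_def d_def)
qed

lemma
  fixes f :: "nat \<Rightarrow> 'a \<Rightarrow> real"
  assumes int: "\<And>k. integrable M (f k)" and nonneg: "\<And>k x. 0 \<le> f k x"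
    and summable: "summable (\<lambda>k. \<integral>x. f k x \<partial>M)"
  shows AE_summable_if_integrals_summable: "AE x in M. summable (\<lambda>k. f k x)"
    and integrable_suminf_if_integrals_summable: "integrable M (\<lambda>x. \<Sum>k. f k x)"
proof -
  have [measurable]: "f k \<in> borel_measurable M" for k
    by (rule borel_measurable_integrable[OF int])
  have "(\<integral>\<^sup>+x. (\<Sum>k. ennreal (f k x)) \<partial>M) = (\<Sum>k. \<integral>\<^sup>+x. ennreal (f k x) \<partial>M)"
    by (rule nn_integral_suminf) auto
  also have "\<dots> = (\<Sum>k. ennreal (\<integral>x. f k x \<partial>M))"
    using int nonneg by (simp add: nn_integral_eq_integral)
  also have "\<dots> = ennreal (\<Sum>k. \<integral>x. f k x \<partial>M)"
    using summable nonneg by (intro suminf_ennreal2) auto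
  finally have "AE x in M. (\<Sum>k. ennreal (f k x)) \<noteq> \<infinity>"
    by (intro nn_integral_noteq_infinite) auto
  then show AE: "AE x in M. summable (\<lambda>k. f k x)"
    by eventually_elim (use nonneg in \<open>auto intro!: summable_suminf_not_top\<close>)
  show "integrable M (\<lambda>x. \<Sum>k. f k x)"
    using AE summable nonneg by (intro integrable_suminf int) auto
qed

lemma L2_fast_Cauchy_dominated_limit:
  fixes f :: "nat \<Rightarrow> 'a \<Rightarrow> 'b::{banach, second_countable_topology}"
  assumes meas [measurable]: "\<And>k. f k \<in> borel_measurable M"
    and f_0: "integrable M (\<lambda>x. (norm (f 0 x))\<^sup>2)"
    and diff: "\<And>k. integrable M (\<lambda>x. (norm (f (Suc k) x - f k x))\<^sup>2)"
    and fast: "\<And>k. (\<integral>x. (norm (f (Suc k) x - f k x))\<^sup>2 \<partial>M) \<le> (1/4) ^ k"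
  obtains g A where "g \<in> borel_measurable M" "integrable M A"
    "AE x in M. (\<lambda>k. f k x) \<longlonglongrightarrow> g x" "AE x in M. \<forall>k. (norm (f k x))\<^sup>2 \<le> A x"
proof -
  define D where "D k x = 2 ^ k * (norm (f (Suc k) x - f k x))\<^sup>2" for k x
  have D: "integrable M (D k)" "0 \<le> D k x" for k x
    unfolding D_def by (auto intro!: integrable_mult_right diff)
  have D_le: "(\<integral>x. D k x \<partial>M) \<le> (1/2) ^ k" for k
  proof -
    have "(\<integral>x. D k x \<partial>M) \<le> 2 ^ k * (1/4) ^ k"
      unfolding D_def using fast[of k] by simp
    also have "\<dots> = (1/2) ^ k"
      by (simp add: power_mult_distrib[symmetric])
    finally show ?thesis .
  qed
  have D_summable: "summable (\<lambda>k. \<integral>x. D k x \<partial>M)"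
    by (rule summable_comparison_test'[of "\<lambda>k. (1/2) ^ k" 0]) (simp_all add: D_le D(2))
  note AE_D = AE_summable_if_integrals_summable[OF D D_summable]
  show ?thesis
  proof
    show "(\<lambda>x. lim (\<lambda>k. f k x)) \<in> borel_measurable M"
      by (rule borel_measurable_lim_metric) auto
    show "integrable M (\<lambda>x. 2 * (norm (f 0 x))\<^sup>2 + 4 * (\<Sum>k. D k x))"
      by (intro Bochner_Integration.integrable_add integrable_mult_right f_0
          integrable_suminf_if_integrals_summable[OF D D_summable])
    show "AE x in M. (\<lambda>k. f k x) \<longlonglongrightarrow> lim (\<lambda>k. f k x)"
      using AE_D by eventually_elim (auto simp: D_def simp flip: convergent_LIMSEQ_iff
          intro: convergent_if_weighted_squares_summable)
    show "AE x in M. \<forall>k. (norm (f k x))\<^sup>2 \<le> 2 * (norm (f 0 x))\<^sup>2 + 4 * (\<Sum>k. D k x)"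
      using AE_D by eventually_elim (auto simp: D_def intro: power2_norm_le_weighted_squares)
  qed
qed

lemma abs_inner_le_sum_squares: "\<bar>x \<bullet> y\<bar> \<le> (norm x)\<^sup>2 + (norm y)\<^sup>2"
  using Cauchy_Schwarz_ineq2[of x y] sum_squares_bound[of "norm x" "norm y"]
    mult_nonneg_nonneg[OF norm_ge_zero[of x] norm_ge_zero[of y]] by linarith

lemma integrable_inner_L2:
  fixes f g :: "'a \<Rightarrow> 'b::{real_inner, second_countable_topology}"
  assumes [measurable]: "f \<in> borel_measurable M" "g \<in> borel_measurable M"
    and "integrable M (\<lambda>x. (norm (f x))\<^sup>2)" "integrable M (\<lambda>x. (norm (g x))\<^sup>2)"
  shows "integrable M (\<lambda>x. f x \<bullet> g x)"
  by (rule Bochner_Integration.integrable_bound[where f="\<lambda>x. (norm (f x))\<^sup>2 + (norm (g x))\<^sup>2"])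
    (use assms abs_inner_le_sum_squares in auto)

section \<open>The extremal function\<close>

locale Szego_weight =
  fixes v :: "real \<Rightarrow> real"
  assumes v_integrable: "integrable arc_measure v"
    and ln_v_integrable: "integrable arc_measure (\<lambda>t. ln (v t))"
    and v_pos: "AE t in arc_measure. 0 < v t"
    and v_nonneg: "\<And>t. 0 \<le> v t"
begin

lemma v_measurable [measurable]: "v \<in> borel_measurable borel"
  using borel_measurable_integrable[OF v_integrable] by simp

definition weighted_eval :: "real poly \<Rightarrow> real \<Rightarrow> complex" where
  "weighted_eval h t = complex_eval h (cis t) * complex_of_real (sqrt (v t))"

definition sqnorm :: "real poly \<Rightarrow> real" where
  "sqnorm h = (\<integral>t. (norm (weighted_eval h t))\<^sup>2 \<partial>arc_measure)"

definition Szego_infimum :: real where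
  "Szego_infimum = Inf (sqnorm ` {h. coeff h 0 = 1})"

lemma weighted_eval_measurable [measurable]: "weighted_eval h \<in> borel_measurable borel"
  unfolding weighted_eval_def[abs_def] by measurable

lemma norm_weighted_eval_sq: "(norm (weighted_eval h t))\<^sup>2 = (norm (complex_eval h (cis t)))\<^sup>2 * v t"
  using v_nonneg[of t] by (simp add: weighted_eval_def norm_mult power_mult_distrib)

lemma weighted_eval_sq_integrable: "integrable arc_measure (\<lambda>t. (norm (weighted_eval h t))\<^sup>2)"
proof -
  obtain B where "\<And>t. norm (complex_eval h (cis t)) \<le> B"
    using complex_eval_cis_bounded by blast
  then have "integrable arc_measure (\<lambda>t. v t * (norm (complex_eval h (cis t)))\<^sup>2)"
    by (intro integrable_mult_bounded[where C="B\<^sup>2"] v_integrable) (auto intro!: power_mono)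
  then show ?thesis
    by (simp add: norm_weighted_eval_sq mult.commute)
qed

lemma integrable_inner_weighted_eval:
  assumes "f \<in> borel_measurable borel" "integrable arc_measure (\<lambda>t. (norm (f t))\<^sup>2)"
  shows "integrable arc_measure (\<lambda>t. weighted_eval h t \<bullet> f t)"
  using assms by (intro integrable_inner_L2 weighted_eval_sq_integrable) auto

lemma weighted_eval_diff: "weighted_eval (h - k) t = weighted_eval h t - weighted_eval k t"
  and weighted_eval_add_smult: "weighted_eval (h + smult s k) t = weighted_eval h t + s *\<^sub>R weighted_eval k t"
  and weighted_eval_smult: "weighted_eval (smult s k) t = s *\<^sub>R weighted_eval k t"
  by (simp_all add: weighted_eval_def scaleR_conv_of_real algebra_simps)

lemma sqnorm_nonneg: "0 \<le> sqnorm h"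
  by (simp add: sqnorm_def)

lemma sqnorm_add_smult:
  "sqnorm (h + smult s r) = sqnorm h + 2 * s * (\<integral>t. weighted_eval r t \<bullet> weighted_eval h t \<partial>arc_measure)
    + s\<^sup>2 * sqnorm r"
proof -
  have "(norm (weighted_eval (h + smult s r) t))\<^sup>2 = (norm (weighted_eval h t))\<^sup>2
      + 2 * s * (weighted_eval r t \<bullet> weighted_eval h t) + s\<^sup>2 * (norm (weighted_eval r t))\<^sup>2" for t
    unfolding weighted_eval_add_smult power2_norm_eq_inner
    by (simp add: inner_add_left inner_add_right inner_commute power2_eq_square)
  then show ?thesis
    unfolding sqnorm_def
    by (simp add: weighted_eval_sq_integrable integrable_inner_weighted_eval)
qed

lemma Szego_infimum_le: "coeff h 0 = 1 \<Longrightarrow> Szego_infimum \<le> sqnorm h"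
  unfolding Szego_infimum_def by (intro cInf_lower bdd_belowI[where m=0]) (auto simp: sqnorm_nonneg)

lemma Szego_infimum_pos: "0 < Szego_infimum"
proof -
  have "exp (\<integral>t. ln (v t) \<partial>arc_measure) \<le> sqnorm h" if "coeff h 0 = 1" for h
    using Szego_lower_bound[OF v_integrable ln_v_integrable v_pos that]
    by (simp add: sqnorm_def norm_weighted_eval_sq)
  then have "exp (\<integral>t. ln (v t) \<partial>arc_measure) \<le> Szego_infimum"
    unfolding Szego_infimum_def by (intro cInf_greatest) (auto intro: exI[of _ 1])
  then show ?thesis
    using exp_gt_zero less_le_trans by blast
qed

lemma near_Szego_infimum:
  assumes "0 < e"
  obtains h where "coeff h 0 = 1" "sqnorm h < Szego_infimum + e"
proof -
  have "\<exists>y\<in>sqnorm ` {h. coeff h 0 = 1}. y < Szego_infimum + e"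
    unfolding Szego_infimum_def using assms by (intro cInf_lessD) (auto intro: exI[of _ 1])
  then show ?thesis
    using that by blast
qed

text \<open>The parallelogram law, with the midpoint competing for the infimum.\<close>
lemma sqnorm_diff_le:
  assumes "coeff h 0 = 1" "coeff k 0 = 1"
  shows "sqnorm (h - k) \<le> 2 * (sqnorm h - Szego_infimum) + 2 * (sqnorm k - Szego_infimum)"
proof -
  have "sqnorm (h + k) = 4 * sqnorm (smult (1/2) (h + k))"
    by (simp add: sqnorm_def weighted_eval_smult power_mult_distrib power2_eq_square del: smult_add_right)
  moreover have "Szego_infimum \<le> sqnorm (smult (1/2) (h + k))"
    using assms by (intro Szego_infimum_le) simp
  moreover have "sqnorm (h - k) + sqnorm (h + k) = 2 * sqnorm h + 2 * sqnorm k"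
    using sqnorm_add_smult[of h 1 k] sqnorm_add_smult[of h "- 1" k] by simp
  ultimately show ?thesis
    by simp
qed

end

locale Szego_extremal = Szego_weight v for v :: "real \<Rightarrow> real" +
  fixes h :: "nat \<Rightarrow> real poly" and g :: "real \<Rightarrow> complex" and A :: "real \<Rightarrow> real"
  assumes h_0: "coeff (h k) 0 = 1"
    and sqnorm_h: "(\<lambda>k. sqnorm (h k)) \<longlonglongrightarrow> Szego_infimum"
    and g_measurable [measurable]: "g \<in> borel_measurable borel"
    and A_integrable: "integrable arc_measure A"
    and weighted_h_lim: "AE t in arc_measure. (\<lambda>k. weighted_eval (h k) t) \<longlonglongrightarrow> g t"
    and weighted_h_le: "AE t in arc_measure. \<forall>k. (norm (weighted_eval (h k) t))\<^sup>2 \<le> A t"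
begin

lemma g_sq_integrable: "integrable arc_measure (\<lambda>t. (norm (g t))\<^sup>2)"
  and integral_g_sq: "(\<integral>t. (norm (g t))\<^sup>2 \<partial>arc_measure) = Szego_infimum"
proof -
  have lim: "AE t in arc_measure. (\<lambda>k. (norm (weighted_eval (h k) t))\<^sup>2) \<longlonglongrightarrow> (norm (g t))\<^sup>2"
    using weighted_h_lim by eventually_elim (intro tendsto_intros)
  have bound: "AE t in arc_measure. norm ((norm (weighted_eval (h k) t))\<^sup>2) \<le> A t" for k
    using weighted_h_le by eventually_elim simp
  show "integrable arc_measure (\<lambda>t. (norm (g t))\<^sup>2)"
    using integrable_dominated_convergence[OF _ _ A_integrable lim bound] by simp
  have "(\<lambda>k. sqnorm (h k)) \<longlonglongrightarrow> (\<integral>t. (norm (g t))\<^sup>2 \<partial>arc_measure)"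
    unfolding sqnorm_def using integral_dominated_convergence[OF _ _ A_integrable lim bound] by simp
  then show "(\<integral>t. (norm (g t))\<^sup>2 \<partial>arc_measure) = Szego_infimum"
    using sqnorm_h LIMSEQ_unique by blast
qed

lemma integral_inner_weighted_h_tendsto:
  assumes [measurable]: "f \<in> borel_measurable borel" and f2: "integrable arc_measure (\<lambda>t. (norm (f t))\<^sup>2)"
  shows "(\<lambda>k. \<integral>t. weighted_eval (h k) t \<bullet> f t \<partial>arc_measure) \<longlonglongrightarrow> (\<integral>t. g t \<bullet> f t \<partial>arc_measure)"
proof (rule integral_dominated_convergence[where w="\<lambda>t. A t + (norm (f t))\<^sup>2"])
  show "AE t in arc_measure. (\<lambda>k. weighted_eval (h k) t \<bullet> f t) \<longlonglongrightarrow> g t \<bullet> f t"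
    using weighted_h_lim by eventually_elim (intro tendsto_intros)
  show "AE t in arc_measure. norm (weighted_eval (h k) t \<bullet> f t) \<le> A t + (norm (f t))\<^sup>2" for k
    using weighted_h_le
    by eventually_elim (auto intro: order_trans[OF abs_inner_le_sum_squares])
qed (use A_integrable f2 in auto)

lemma orthogonal_extremal:
  assumes "coeff r 0 = 0"
  shows "(\<integral>t. weighted_eval r t \<bullet> g t \<partial>arc_measure) = 0" (is "?b = 0")
proof -
  have nonneg: "0 \<le> 2 * s * ?b + s\<^sup>2 * sqnorm r" for s
  proof -
    have "(\<lambda>k. sqnorm (h k + smult s r)) \<longlonglongrightarrow> Szego_infimum + 2 * s * ?b + s\<^sup>2 * sqnorm r"
      unfolding sqnorm_add_smult inner_commute[of "weighted_eval r _"]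
      by (intro tendsto_intros sqnorm_h integral_inner_weighted_h_tendsto weighted_eval_sq_integrable) simp
    then have "Szego_infimum \<le> Szego_infimum + 2 * s * ?b + s\<^sup>2 * sqnorm r"
      by (rule LIMSEQ_le_const) (use assms h_0 in \<open>auto intro!: Szego_infimum_le\<close>)
    then show ?thesis
      by simp
  qed
  define c where "c = sqnorm r + 1"
  have c: "0 < c" "sqnorm r \<le> c"
    using sqnorm_nonneg[of r] by (auto simp: c_def)
  have "0 \<le> 2 * (- ?b / c) * ?b + (- ?b / c)\<^sup>2 * c"
    using order_trans[OF nonneg[of "- ?b / c"] add_left_mono[OF mult_left_mono[OF c(2)]]] by simp
  also have "\<dots> = - (?b\<^sup>2 / c)"
    using c(1) by (simp add: power2_eq_square field_simps)
  finally show ?thesis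
    using c(1) by (simp add: divide_le_0_iff)
qed

lemma integral_inner_extremal: "(\<integral>t. weighted_eval r t \<bullet> g t \<partial>arc_measure) = coeff r 0 * Szego_infimum"
proof -
  have "(\<integral>t. weighted_eval r t \<bullet> g t \<partial>arc_measure)
      = coeff r 0 * (\<integral>t. weighted_eval (h k) t \<bullet> g t \<partial>arc_measure)" for k
  proof -
    have "(\<integral>t. weighted_eval (r - smult (coeff r 0) (h k)) t \<bullet> g t \<partial>arc_measure) = 0"
      by (rule orthogonal_extremal) (simp add: h_0)
    then show ?thesis
      by (simp add: weighted_eval_diff weighted_eval_smult
          inner_diff_left integrable_inner_weighted_eval g_sq_integrable)
  qed
  moreover have "(\<lambda>k. coeff r 0 * (\<integral>t. weighted_eval (h k) t \<bullet> g t \<partial>arc_measure)) \<longlonglongrightarrow> coeff r 0 * Szego_infimum"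
    using integral_inner_weighted_h_tendsto[OF _ g_sq_integrable]
    by (intro tendsto_mult_left) (simp add: integral_g_sq flip: power2_norm_eq_inner)
  ultimately show ?thesis
    by (simp add: LIMSEQ_const_iff)
qed

lemma Fourier_coefficients_extremal:
  "(\<integral>t. (norm (g t))\<^sup>2 * cos (real n * t) \<partial>arc_measure) = (if n = 0 then Szego_infimum else 0)"
proof (cases "n = 0")
  case False
  have "(\<integral>t. weighted_eval (h k) t \<bullet> (cis (- (real n * t)) * g t) \<partial>arc_measure) = 0" for k
  proof -
    have "weighted_eval (monom 1 n * h k) t = cis (real n * t) * weighted_eval (h k) t" for t
      by (simp add: weighted_eval_def Complex.DeMoivre mult_ac)
    then have "weighted_eval (h k) t \<bullet> (cis (- (real n * t)) * g t)
        = weighted_eval (monom 1 n * h k) t \<bullet> g t" for t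
      by (simp add: inner_complex_def algebra_simps)
    then show ?thesis
      using False by (simp add: integral_inner_extremal coeff_mult)
  qed
  moreover have "g t \<bullet> (cis (- (real n * t)) * g t) = (norm (g t))\<^sup>2 * cos (real n * t)" for t
    unfolding cmod_power2 by (simp add: inner_complex_def power2_eq_square algebra_simps)
  moreover have "(\<lambda>k. \<integral>t. weighted_eval (h k) t \<bullet> (cis (- (real n * t)) * g t) \<partial>arc_measure)
      \<longlonglongrightarrow> (\<integral>t. g t \<bullet> (cis (- (real n * t)) * g t) \<partial>arc_measure)"
    by (rule integral_inner_weighted_h_tendsto) (simp_all add: norm_mult g_sq_integrable)
  ultimately show ?thesis
    using False by (simp add: LIMSEQ_const_iff)
qed (simp add: integral_g_sq)

lemma AE_norm_extremal: "AE t in arc_measure. (norm (g t))\<^sup>2 = Szego_infimum"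
proof -
  have "AE t in arc_measure. (norm (g t))\<^sup>2 - Szego_infimum = 0"
  proof (rule Fourier_cosine_unique)
    show "integrable arc_measure (\<lambda>t. (norm (g t))\<^sup>2 - Szego_infimum)"
      using g_sq_integrable by simp
    fix n :: nat
    have "integrable arc_measure (\<lambda>t. (norm (g t))\<^sup>2 * cos (real n * t))"
      by (intro integrable_mult_bounded[where C=1] g_sq_integrable) auto
    moreover have "integrable arc_measure (\<lambda>t. cos (real n * t))"
      by (intro integrable_arc_measure_bounded[where C=1]) auto
    ultimately show "(\<integral>t. ((norm (g t))\<^sup>2 - Szego_infimum) * cos (real n * t) \<partial>arc_measure) = 0"
      by (simp add: left_diff_distrib Fourier_coefficients_extremal integral_cos_multiple_arc_measure)
  qed
  then show ?thesis
    by simp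
qed

end

lemma (in Szego_weight) exists_Szego_extremal: obtains h g A where "Szego_extremal v h g A"
proof -
  have "\<exists>h. coeff h 0 = 1 \<and> sqnorm h < Szego_infimum + (1/4) ^ k / 4" for k
    using near_Szego_infimum[of "(1/4) ^ k / 4"] by auto
  then obtain h where h_0: "\<And>k. coeff (h k) 0 = 1"
    and h_less: "\<And>k. sqnorm (h k) < Szego_infimum + (1/4) ^ k / 4"
    by metis
  have h_lim: "(\<lambda>k. sqnorm (h k)) \<longlonglongrightarrow> Szego_infimum"
  proof (rule tendsto_sandwich)
    show "\<forall>\<^sub>F k in sequentially. Szego_infimum \<le> sqnorm (h k)"
      by (intro always_eventually allI Szego_infimum_le h_0)
    show "\<forall>\<^sub>F k in sequentially. sqnorm (h k) \<le> Szego_infimum + (1/4) ^ k / 4"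
      by (intro always_eventually allI less_imp_le h_less)
    show "(\<lambda>k. Szego_infimum + (1/4) ^ k / 4) \<longlonglongrightarrow> Szego_infimum"
      by (auto intro!: tendsto_eq_intros LIMSEQ_realpow_zero)
  qed simp
  have fast: "(\<integral>t. (norm (weighted_eval (h (Suc k)) t - weighted_eval (h k) t))\<^sup>2 \<partial>arc_measure)
      \<le> (1/4) ^ k" for k
  proof -
    have "sqnorm (h (Suc k) - h k)
      \<le> 2 * (sqnorm (h (Suc k)) - Szego_infimum) + 2 * (sqnorm (h k) - Szego_infimum)"
      by (intro sqnorm_diff_le h_0)
    also have "\<dots> \<le> 2 * ((1/4) ^ Suc k / 4) + 2 * ((1/4) ^ k / 4)"
      using h_less[of k] h_less[of "Suc k"] by (intro add_mono mult_left_mono) simp_all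
    also have "\<dots> \<le> (1/4) ^ k"
      by simp
    finally show ?thesis
      by (simp add: sqnorm_def weighted_eval_diff)
  qed
  have diff: "integrable arc_measure (\<lambda>t. (norm (weighted_eval (h (Suc k)) t - weighted_eval (h k) t))\<^sup>2)" for k
    unfolding weighted_eval_diff[symmetric] by (rule weighted_eval_sq_integrable)
  obtain g A where "g \<in> borel_measurable arc_measure" "integrable arc_measure A"
    "AE t in arc_measure. (\<lambda>k. weighted_eval (h k) t) \<longlonglongrightarrow> g t"
    "AE t in arc_measure. \<forall>k. (norm (weighted_eval (h k) t))\<^sup>2 \<le> A t"
    by (rule L2_fast_Cauchy_dominated_limit
        [of "\<lambda>k. weighted_eval (h k)" arc_measure, OF _ weighted_eval_sq_integrable diff fast]) simp
  then have "Szego_extremal v h g A"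
    using h_0 h_lim by unfold_locales auto
  then show ?thesis
    by (rule that)
qed

lemma (in Szego_weight) extremal_phase:
  obtains u where "u \<in> borel_measurable borel" "\<And>t. norm (u t) = 1"
    "\<And>r. (\<integral>t. Re (u t * complex_eval r (cis t)) * sqrt (v t) \<partial>arc_measure) = coeff r 0 * sqrt Szego_infimum"
proof -
  obtain h g A where "Szego_extremal v h g A"
    by (rule exists_Szego_extremal)
  then interpret Szego_extremal v h g A .
  define u where "u t = (if (norm (g t))\<^sup>2 = Szego_infimum
      then cnj (g t) / complex_of_real (sqrt Szego_infimum) else 1)" for t
  show ?thesis
  proof
    show [measurable]: "u \<in> borel_measurable borel"
      unfolding u_def[abs_def] by measurable
    show "norm (u t) = 1" for t
    proof -
      have "norm (g t) = sqrt Szego_infimum" if "(norm (g t))\<^sup>2 = Szego_infimum"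
        using that by (metis abs_of_nonneg norm_ge_zero real_sqrt_abs)
      then show ?thesis
        using Szego_infimum_pos by (auto simp: u_def norm_divide)
    qed
    fix r
    have "(\<integral>t. Re (u t * complex_eval r (cis t)) * sqrt (v t) \<partial>arc_measure)
        = (\<integral>t. (weighted_eval r t \<bullet> g t) / sqrt Szego_infimum \<partial>arc_measure)"
    proof (rule integral_cong_AE)
      show "AE t in arc_measure. Re (u t * complex_eval r (cis t)) * sqrt (v t)
          = (weighted_eval r t \<bullet> g t) / sqrt Szego_infimum"
        using AE_norm_extremal
        by eventually_elim
          (simp add: u_def weighted_eval_def inner_complex_def Re_divide_of_real Im_divide_of_real
            add_divide_distrib diff_divide_distrib algebra_simps)
    qed measurable
    also have "\<dots> = coeff r 0 * sqrt Szego_infimum"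
      using Szego_infimum_pos by (simp add: integral_inner_extremal real_div_sqrt flip: times_divide_eq_right)
    finally show "(\<integral>t. Re (u t * complex_eval r (cis t)) * sqrt (v t) \<partial>arc_measure)
      = coeff r 0 * sqrt Szego_infimum" .
  qed
qed

section \<open>Mean square asymptotics of orthonormal polynomials\<close>

lemma exists_poly_cos_eq_oscillation:
  assumes h_0: "coeff h 0 = 1" and n: "degree h < n"
  obtains q where "degree q \<le> n" "coeff q n = 2 ^ n"
    "\<And>t. poly q (cos t) = 2 * oscillation (\<lambda>t. cnj (complex_eval h (cis t))) n t"
proof -
  define q where "q = (\<Sum>i\<le>degree h. smult (2 * coeff h i) (Chebyshev_T (n - i)))"
  have "degree q \<le> n"
    unfolding q_def
    by (intro degree_sum_le order_trans[OF degree_smult_le] order_trans[OF degree_Chebyshev_T_le]) auto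
  moreover have "coeff q n = 2 ^ n"
  proof -
    have "coeff q n = (\<Sum>i\<le>degree h. 2 * coeff h i * coeff (Chebyshev_T (n - i)) n)"
      by (simp add: q_def coeff_sum)
    also have "\<dots> = (\<Sum>i\<in>{0}. 2 * coeff h i * coeff (Chebyshev_T (n - i)) n)"
    proof (intro sum.mono_neutral_right ballI)
      fix i assume "i \<in> {..degree h} - {0}"
      then show "2 * coeff h i * coeff (Chebyshev_T (n - i)) n = 0"
        using degree_Chebyshev_T_le[of "n - i"] n by (auto intro!: coeff_eq_0)
    qed auto
    also have "\<dots> = 2 ^ n"
      using n h_0 by (cases n) (simp_all add: coeff_Chebyshev_T)
    finally show ?thesis .
  qed
  moreover have "poly q (cos t) = 2 * oscillation (\<lambda>t. cnj (complex_eval h (cis t))) n t" for t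
  proof -
    have "cnj (cis t ^ i) * cis (real n * t) = cis (real (n - i) * t)" if "i \<le> degree h" for i
      using that n by (simp add: Complex.DeMoivre cis_cnj cis_mult of_nat_diff algebra_simps)
    then have "cnj (complex_eval h (cis t)) * cis (real n * t)
        = (\<Sum>i\<le>degree h. complex_of_real (coeff h i) * cis (real (n - i) * t))"
      unfolding complex_eval_altdef by (simp add: sum_distrib_right mult.assoc del: complex_cnj_power)
    then show ?thesis
      by (simp add: oscillation_def q_def poly_sum poly_Chebyshev_T_cos sum_distrib_left mult.assoc
        del: times_complex.sel)
        simp
  qed
  ultimately show ?thesis
    using that by blast
qed

lemma complex_eval_half_sum: "complex_eval [:1/2, 0, 1/2:] (cis t) = complex_of_real (cos t) * cis t"
proof -
  have "complex_of_real (cos t) = (cis t + cis (- t)) / 2"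
    by (simp add: complex_eq_iff)
  then show ?thesis
    by (simp add: ring_distribs cis_mult add_divide_distrib)
qed

lemma exists_complex_eval_eq_poly_cos_mult_cis:
  assumes "degree p \<le> n"
  obtains R where "coeff R 0 = coeff p n / 2 ^ n"
    "\<And>t. complex_eval R (cis t) = complex_of_real (poly p (cos t)) * cis (real n * t)"
proof -
  define R where "R = (\<Sum>i\<le>n. smult (coeff p i) (monom 1 (n - i) * [:1/2, 0, 1/2:] ^ i))"
  have "coeff R 0 = (\<Sum>i\<le>n. coeff p i * ((if n - i = 0 then 1 else 0) * (1/2) ^ i))"
    by (simp add: R_def coeff_sum coeff_mult_0 coeff_0_power)
  also have "\<dots> = (\<Sum>i\<in>{n}. coeff p i * ((if n - i = 0 then 1 else 0) * (1/2) ^ i))"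
    by (intro sum.mono_neutral_right) auto
  also have "\<dots> = coeff p n / 2 ^ n"
    by (simp add: power_one_over)
  finally have "coeff R 0 = coeff p n / 2 ^ n" .
  moreover have "complex_eval R (cis t) = complex_of_real (poly p (cos t)) * cis (real n * t)" for t
  proof -
    have summand: "cis t ^ (n - i) * (complex_of_real (cos t) * cis t) ^ i
        = complex_of_real (cos t ^ i) * cis (real n * t)" if "i \<le> n" for i
    proof -
      have "cis t ^ (n - i) * cis t ^ i = cis (real n * t)"
        using that by (simp flip: Complex.DeMoivre power_add)
      then show ?thesis
        by (simp add: power_mult_distrib mult_ac)
    qed
    have "complex_eval R (cis t)
        = (\<Sum>i\<le>n. complex_of_real (coeff p i) * (cis t ^ (n - i) * (complex_of_real (cos t) * cis t) ^ i))"
      unfolding R_def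
      by (simp only: complex_eval_sum complex_eval_smult complex_eval_mult complex_eval_power
          complex_eval_half_sum complex_eval_monom) simp
    also have "\<dots> = complex_of_real (\<Sum>i\<le>n. coeff p i * cos t ^ i) * cis (real n * t)"
      by (simp add: summand sum_distrib_right mult.assoc)
    also have "(\<Sum>i\<le>n. coeff p i * cos t ^ i) = poly (\<Sum>i\<le>n. monom (coeff p i) i) (cos t)"
      by (simp add: poly_sum poly_monom)
    also have "(\<Sum>i\<le>n. monom (coeff p i) i) = p"
      by (rule poly_as_sum_of_monoms'[OF assms])
    finally show ?thesis .
  qed
  ultimately show ?thesis
    using that by blast
qed

locale Szego_orthonormal = Szego_weight +
  fixes p :: "nat \<Rightarrow> real poly"
  assumes degree_p: "degree (p n) = n"
    and lead_coeff_p: "0 < coeff (p n) n"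
    and orthonormal: "(\<integral>t. poly (p n) (cos t) * poly (p m) (cos t) * v t \<partial>arc_measure)
      = (if m = n then 1 else 0)"
begin

lemma integrable_poly_cos_weight: "integrable arc_measure (\<lambda>t. poly q (cos t) * poly r (cos t) * v t)"
  using integrable_mult_continuous_cos[OF v_integrable, of "poly (q * r)"]
    continuous_on_poly[OF continuous_on_id, of UNIV "q * r"]
  by (simp add: mult_ac)

lemma orthogonal_lower_degree:
  assumes "r = 0 \<or> degree r < n"
  shows "(\<integral>t. poly (p n) (cos t) * poly r (cos t) * v t \<partial>arc_measure) = 0"
  using assms
proof (induction "degree r" arbitrary: r rule: less_induct)
  case less
  define m where "m = degree r"
  define c where "c = coeff r m / coeff (p m) m"
  define r' where "r' = r - smult c (p m)"
  show ?case
  proof (cases "r = 0")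
    case False
    then have m: "m < n"
      using less.prems by (simp add: m_def)
    have "degree r' \<le> m"
      unfolding r'_def by (intro degree_diff_le order_trans[OF degree_smult_le]) (simp_all add: m_def degree_p)
    moreover have "coeff r' m = 0"
      using lead_coeff_p[of m] by (simp add: r'_def c_def)
    ultimately have "r' = 0 \<or> degree r' < m"
      by (rule eq_zero_or_degree_less)
    then have "(\<integral>t. poly (p n) (cos t) * poly r' (cos t) * v t \<partial>arc_measure) = 0"
      using less.hyps[of r'] m by (auto simp: m_def)
    moreover have "poly (p n) (cos t) * poly r' (cos t) * v t
        = poly (p n) (cos t) * poly r (cos t) * v t - c * (poly (p n) (cos t) * poly (p m) (cos t) * v t)" for t
      by (simp add: r'_def algebra_simps)
    ultimately show ?thesis
      using m orthonormal[of n m] integrable_poly_cos_weight by simp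
  qed simp
qed

lemma lead_coeff_extremal:
  assumes "degree q \<le> n"
  shows "(coeff q n / coeff (p n) n)\<^sup>2 \<le> (\<integral>t. (poly q (cos t))\<^sup>2 * v t \<partial>arc_measure)"
proof -
  define c where "c = coeff q n / coeff (p n) n"
  define r where "r = q - smult c (p n)"
  have "degree r \<le> n"
    unfolding r_def by (intro degree_diff_le order_trans[OF degree_smult_le] assms) (simp add: degree_p)
  moreover have "coeff r n = 0"
    using lead_coeff_p[of n] by (simp add: r_def c_def)
  ultimately have "(\<integral>t. poly (p n) (cos t) * poly r (cos t) * v t \<partial>arc_measure) = 0"
    by (intro orthogonal_lower_degree eq_zero_or_degree_less)
  moreover have "(poly q (cos t))\<^sup>2 * v t = c\<^sup>2 * (poly (p n) (cos t) * poly (p n) (cos t) * v t)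
      + 2 * c * (poly (p n) (cos t) * poly r (cos t) * v t) + poly r (cos t) * poly r (cos t) * v t" for t
    by (simp add: r_def power2_eq_square algebra_simps)
  moreover have "0 \<le> (\<integral>t. poly r (cos t) * poly r (cos t) * v t \<partial>arc_measure)"
    using v_nonneg by (intro Bochner_Integration.integral_nonneg) auto
  ultimately show ?thesis
    using orthonormal[of n n] integrable_poly_cos_weight by (simp add: c_def)
qed

definition scaled_lead_coeff :: "nat \<Rightarrow> real" where
  "scaled_lead_coeff n = coeff (p n) n / 2 ^ n"

lemma scaled_lead_coeff_pos: "0 < scaled_lead_coeff n"
  using lead_coeff_p by (simp add: scaled_lead_coeff_def)

lemma inverse_scaled_lead_coeff_sq_le:
  assumes "coeff h 0 = 1" "degree h < n"
  shows "(1 / scaled_lead_coeff n)\<^sup>2 \<le> 4 * (\<integral>t. (oscillation (\<lambda>t. cnj (weighted_eval h t)) n t)\<^sup>2 \<partial>arc_measure)"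
proof -
  obtain q where q: "degree q \<le> n" "coeff q n = 2 ^ n"
      "\<And>t. poly q (cos t) = 2 * oscillation (\<lambda>t. cnj (complex_eval h (cis t))) n t"
    using exists_poly_cos_eq_oscillation[OF assms] by blast
  have "(poly q (cos t))\<^sup>2 * v t = 4 * (oscillation (\<lambda>t. cnj (weighted_eval h t)) n t)\<^sup>2" for t
  proof -
    have "poly q (cos t) * sqrt (v t) = 2 * oscillation (\<lambda>t. cnj (weighted_eval h t)) n t"
      by (simp add: q(3) oscillation_def weighted_eval_def algebra_simps)
    then have "(poly q (cos t))\<^sup>2 * (sqrt (v t))\<^sup>2 = 4 * (oscillation (\<lambda>t. cnj (weighted_eval h t)) n t)\<^sup>2"
      by (simp flip: power_mult_distrib)
    then show ?thesis
      using v_nonneg[of t] by simp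
  qed
  then show ?thesis
    using lead_coeff_extremal[OF q(1)] by (simp add: q(2) scaled_lead_coeff_def)
qed

lemma eventually_scaled_lead_coeff_greater:
  assumes "0 < a" "a < 1"
  shows "\<forall>\<^sub>F n in sequentially. a < sqrt (2 * Szego_infimum) * scaled_lead_coeff n"
proof -
  have "a\<^sup>2 < 1"
    using assms by (simp add: abs_square_less_1)
  then have "0 < Szego_infimum / a\<^sup>2 - Szego_infimum"
    using assms Szego_infimum_pos by (simp add: field_simps)
  then obtain h where h_0: "coeff h 0 = 1" and h: "sqnorm h < Szego_infimum / a\<^sup>2"
    using near_Szego_infimum[of "Szego_infimum / a\<^sup>2 - Szego_infimum"] by auto
  define f where "f t = cnj (weighted_eval h t)" for t
  have "(\<lambda>n. \<integral>t. (oscillation f n t)\<^sup>2 \<partial>arc_measure) \<longlonglongrightarrow> sqnorm h / 2"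
    using mean_square_oscillation_tendsto[of f] weighted_eval_sq_integrable[of h]
    by (simp add: f_def[abs_def] sqnorm_def)
  then have "\<forall>\<^sub>F n in sequentially. (\<integral>t. (oscillation f n t)\<^sup>2 \<partial>arc_measure) < (Szego_infimum / a\<^sup>2) / 2"
    using h by (intro order_tendstoD(2)) auto
  moreover have "\<forall>\<^sub>F n in sequentially. degree h < n"
    by (rule eventually_gt_at_top)
  ultimately show ?thesis
  proof eventually_elim
    case (elim n)
    have "(1 / scaled_lead_coeff n)\<^sup>2 < 2 * Szego_infimum / a\<^sup>2"
      using inverse_scaled_lead_coeff_sq_le[OF h_0 elim(2)] elim(1) by (simp add: f_def[abs_def])
    then have "a\<^sup>2 < 2 * Szego_infimum * (scaled_lead_coeff n)\<^sup>2"
      using assms scaled_lead_coeff_pos[of n] by (simp add: field_simps)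
    also have "\<dots> = (sqrt (2 * Szego_infimum) * scaled_lead_coeff n)\<^sup>2"
      using Szego_infimum_pos by (simp add: power_mult_distrib)
    finally show ?case
      using Szego_infimum_pos scaled_lead_coeff_pos[of n] by (auto intro: power2_less_imp_less)
  qed
qed

definition weighted_p :: "nat \<Rightarrow> real \<Rightarrow> real" where
  "weighted_p n t = poly (p n) (cos t) * sqrt (v t)"

lemma weighted_p_measurable [measurable]: "weighted_p n \<in> borel_measurable borel"
  unfolding weighted_p_def[abs_def] by measurable

lemma weighted_p_sq: "(weighted_p n t)\<^sup>2 = (poly (p n) (cos t))\<^sup>2 * v t"
  using v_nonneg[of t] by (simp add: weighted_p_def power_mult_distrib)

lemma weighted_p_sq_integrable: "integrable arc_measure (\<lambda>t. (weighted_p n t)\<^sup>2)"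
  and integral_weighted_p_sq: "(\<integral>t. (weighted_p n t)\<^sup>2 \<partial>arc_measure) = 1"
  using integrable_poly_cos_weight[of "p n" "p n"] orthonormal[of n n]
  unfolding weighted_p_sq by (simp_all add: power2_eq_square)

lemma
  assumes [measurable]: "u \<in> borel_measurable borel" and u: "\<And>t. norm (u t) = 1"
  shows weighted_p_diff_oscillation_sq_integrable:
      "integrable arc_measure (\<lambda>t. (weighted_p n t - sqrt 2 * oscillation u n t)\<^sup>2)"
    and integral_weighted_p_diff_oscillation_sq:
      "(\<integral>t. (weighted_p n t - sqrt 2 * oscillation u n t)\<^sup>2 \<partial>arc_measure)
        = 1 + 2 * (\<integral>t. (oscillation u n t)\<^sup>2 \<partial>arc_measure)
          - 2 * sqrt 2 * (\<integral>t. weighted_p n t * oscillation u n t \<partial>arc_measure)"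
proof -
  have square: "(weighted_p n t - sqrt 2 * oscillation u n t)\<^sup>2
      = (weighted_p n t)\<^sup>2 + 2 * (oscillation u n t)\<^sup>2
        - 2 * sqrt 2 * (weighted_p n t * oscillation u n t)" for t
    by (simp add: power2_diff power_mult_distrib)
  have osc_sq: "integrable arc_measure (\<lambda>t. (oscillation u n t)\<^sup>2)"
    using abs_oscillation_le[of u n]
    by (intro integrable_arc_measure_bounded[where C=1]) (auto simp: u abs_square_le_1)
  have "integrable arc_measure (\<lambda>t. weighted_p n t \<bullet> oscillation u n t)"
    using osc_sq weighted_p_sq_integrable by (intro integrable_inner_L2) auto
  then have product: "integrable arc_measure (\<lambda>t. weighted_p n t * oscillation u n t)"
    by simp
  show "integrable arc_measure (\<lambda>t. (weighted_p n t - sqrt 2 * oscillation u n t)\<^sup>2)"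
    unfolding square using osc_sq product weighted_p_sq_integrable by simp
  show "(\<integral>t. (weighted_p n t - sqrt 2 * oscillation u n t)\<^sup>2 \<partial>arc_measure)
      = 1 + 2 * (\<integral>t. (oscillation u n t)\<^sup>2 \<partial>arc_measure)
        - 2 * sqrt 2 * (\<integral>t. weighted_p n t * oscillation u n t \<partial>arc_measure)"
    unfolding square using osc_sq product weighted_p_sq_integrable by (simp add: integral_weighted_p_sq)
qed

lemma integral_weighted_p_mult_oscillation:
  assumes "\<And>r. (\<integral>t. Re (u t * complex_eval r (cis t)) * sqrt (v t) \<partial>arc_measure) = coeff r 0 * s"
  shows "(\<integral>t. weighted_p n t * oscillation u n t \<partial>arc_measure) = scaled_lead_coeff n * s"
proof -
  obtain R where R: "coeff R 0 = coeff (p n) n / 2 ^ n"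
      "\<And>t. complex_eval R (cis t) = complex_of_real (poly (p n) (cos t)) * cis (real n * t)"
    using exists_complex_eval_eq_poly_cos_mult_cis[of "p n" n] degree_p by auto
  have "weighted_p n t * oscillation u n t = Re (u t * complex_eval R (cis t)) * sqrt (v t)" for t
    by (simp add: R(2) weighted_p_def oscillation_def algebra_simps)
  then show ?thesis
    by (simp only: assms) (simp add: R(1) scaled_lead_coeff_def)
qed

theorem L2_asymptotics:
  obtains u where "u \<in> borel_measurable borel" "\<And>t. norm (u t) = 1"
    "(\<lambda>n. \<integral>t. (weighted_p n t - sqrt 2 * oscillation u n t)\<^sup>2 \<partial>arc_measure) \<longlonglongrightarrow> 0"
proof -
  obtain u where u: "u \<in> borel_measurable borel" "\<And>t. norm (u t) = 1"
    and inner_u: "\<And>r. (\<integral>t. Re (u t * complex_eval r (cis t)) * sqrt (v t) \<partial>arc_measure)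
      = coeff r 0 * sqrt Szego_infimum"
    using extremal_phase by blast
  define D where "D n = (\<integral>t. (weighted_p n t - sqrt 2 * oscillation u n t)\<^sup>2 \<partial>arc_measure)" for n
  define b where "b n = 2 * (\<integral>t. (oscillation u n t)\<^sup>2 \<partial>arc_measure)" for n
  define c where "c n = sqrt (2 * Szego_infimum) * scaled_lead_coeff n" for n
  have D_eq: "D n = 1 + b n - 2 * c n" for n
    using integral_weighted_p_mult_oscillation[OF inner_u, of n]
    by (simp add: D_def b_def c_def integral_weighted_p_diff_oscillation_sq[OF u] real_sqrt_mult)
  have "b \<longlonglongrightarrow> 2 * ((\<integral>t. (norm (u t))\<^sup>2 \<partial>arc_measure) / 2)"
    unfolding b_def[abs_def] using u by (intro tendsto_mult_left mean_square_oscillation_tendsto) simp_all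
  then have b_lim: "b \<longlonglongrightarrow> 1"
    by (simp add: u)
  have "D \<longlonglongrightarrow> 0"
  proof (rule order_tendstoI)
    fix e :: real
    assume "e < 0"
    then show "\<forall>\<^sub>F n in sequentially. e < D n"
      unfolding D_def by (intro always_eventually allI less_le_trans[OF _ Bochner_Integration.integral_nonneg])
        auto
  next
    fix e :: real
    assume "0 < e"
    define a where "a = max (1 - e / 4) (1 / 2)"
    have "\<forall>\<^sub>F n in sequentially. a < c n"
      using \<open>0 < e\<close> unfolding c_def by (intro eventually_scaled_lead_coeff_greater) (auto simp: a_def)
    moreover have "\<forall>\<^sub>F n in sequentially. b n < 1 + e / 2"
      using b_lim \<open>0 < e\<close> by (intro order_tendstoD(2)) auto
    ultimately show "\<forall>\<^sub>F n in sequentially. D n < e"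
      unfolding D_eq by eventually_elim (auto simp: a_def)
  qed
  then show ?thesis
    unfolding D_def[abs_def] by (rule that[OF u])
qed

end

section \<open>Entropy of the arcsine law\<close>

definition entropy_fun :: "real \<Rightarrow> real" where
  "entropy_fun x = x\<^sup>2 * ln (x\<^sup>2)"

lemma continuous_on_x_ln_x: "continuous_on {0..} (\<lambda>x::real. x * ln x)"
  unfolding continuous_on_def
proof
  fix x :: real
  assume "x \<in> {0..}"
  show "((\<lambda>x. x * ln x) \<longlongrightarrow> x * ln x) (at x within {0..})"
  proof (cases "x = 0")
    case True
    have "((\<lambda>x::real. x * ln x) \<longlongrightarrow> 0) (at_right 0)"
      by real_asymp
    then show ?thesis
      by (simp add: True at_within_Ici_at_right)
  next
    case False
    then show ?thesis
      using \<open>x \<in> {0..}\<close> by (intro tendsto_intros) auto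
  qed
qed

lemma continuous_on_entropy_fun: "continuous_on UNIV entropy_fun"
  unfolding entropy_fun_def
  by (rule continuous_on_compose2[OF continuous_on_x_ln_x, where f="\<lambda>x. x\<^sup>2"]) (auto intro!: continuous_intros)

lemma continuous_on_compose_entropy_fun [continuous_intros]:
  "continuous_on S f \<Longrightarrow> continuous_on S (\<lambda>x. entropy_fun (f x))"
  by (rule continuous_on_compose2[OF continuous_on_entropy_fun]) auto

lemma borel_measurable_entropy_fun [measurable]: "entropy_fun \<in> borel_measurable borel"
  by (rule borel_measurable_continuous_onI[OF continuous_on_entropy_fun])

lemma entropy_fun_mult:
  assumes "a \<noteq> 0"
  shows "entropy_fun (a * x) = a\<^sup>2 * entropy_fun x + a\<^sup>2 * ln (a\<^sup>2) * x\<^sup>2"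
  using assms by (cases "x = 0") (simp_all add: entropy_fun_def power_mult_distrib ln_mult_pos algebra_simps)

lemma tendsto_power2_mult_Ln: "((\<lambda>z. z\<^sup>2 * Ln z) \<longlongrightarrow> 0) (at 0)"
proof (rule Lim_null_comparison)
  have "norm (z\<^sup>2 * Ln z) \<le> (norm z)\<^sup>2 * (\<bar>ln (norm z)\<bar> + pi)" if "z \<noteq> 0" for z :: complex
  proof -
    have "\<bar>Im (Ln z)\<bar> \<le> pi"
      using mpi_less_Im_Ln[OF that] Im_Ln_le_pi[OF that] by linarith
    then have "norm (Ln z) \<le> \<bar>ln (norm z)\<bar> + pi"
      using cmod_le[of "Ln z"] that by simp
    then show ?thesis
      by (simp add: norm_mult norm_power mult_left_mono)
  qed
  then show "\<forall>\<^sub>F z in at 0. norm (z\<^sup>2 * Ln z) \<le> (norm z)\<^sup>2 * (\<bar>ln (norm z)\<bar> + pi)"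
    by (auto simp: eventually_at_filter)
  have "filterlim norm (at_right 0) (at (0::complex))"
    by (auto simp: filterlim_at eventually_at_filter intro!: tendsto_norm_zero tendsto_ident_at)
  moreover have "((\<lambda>x::real. x\<^sup>2 * (\<bar>ln x\<bar> + pi)) \<longlongrightarrow> 0) (at_right 0)"
    by real_asymp
  ultimately show "((\<lambda>z::complex. (norm z)\<^sup>2 * (\<bar>ln (norm z)\<bar> + pi)) \<longlongrightarrow> 0) (at 0)"
    by (rule filterlim_compose[rotated])
qed

text \<open>On the unit circle \<open>(1 + z)\<^sup>2 / z = \<bar>1 + z\<bar>\<^sup>2\<close>, so twice the real part of this function is
  \<open>entropy_fun \<bar>1 + z\<bar>\<close>, whose mean can then be read off at \<open>0\<close>.\<close>
definition Ln_kernel :: "complex \<Rightarrow> complex" where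
  "Ln_kernel z = (1 + z)\<^sup>2 * (if z = 0 then 1 else Ln (1 + z) / z)"

lemma Ln_kernel_holomorphic: "Ln_kernel holomorphic_on {z. 1 + z \<notin> \<real>\<^sub>\<le>\<^sub>0}"
  and open_Ln_kernel_domain: "open {z::complex. 1 + z \<notin> \<real>\<^sub>\<le>\<^sub>0}"
proof -
  have "open ((\<lambda>z::complex. 1 + z) -` (- \<real>\<^sub>\<le>\<^sub>0))"
    by (intro open_vimage continuous_intros) (simp add: open_Compl)
  then show "open": "open {z::complex. 1 + z \<notin> \<real>\<^sub>\<le>\<^sub>0}"
    by (simp add: vimage_def)
  have "deriv (\<lambda>z. Ln (1 + z)) 0 = 1"
    by (rule DERIV_imp_deriv) (auto intro!: derivative_eq_intros)
  moreover have "(\<lambda>z. Ln (1 + z)) holomorphic_on {z. 1 + z \<notin> \<real>\<^sub>\<le>\<^sub>0}"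
    by (intro holomorphic_intros) auto
  ultimately have "(\<lambda>z. if z = 0 then 1 else Ln (1 + z) / z) holomorphic_on {z. 1 + z \<notin> \<real>\<^sub>\<le>\<^sub>0}"
    using pole_lemma_open[OF _ "open", of "\<lambda>z. Ln (1 + z)" 0] by (simp cong: if_cong)
  then show "Ln_kernel holomorphic_on {z. 1 + z \<notin> \<real>\<^sub>\<le>\<^sub>0}"
    unfolding Ln_kernel_def[abs_def] by (intro holomorphic_intros)
qed

lemma continuous_on_Ln_kernel: "continuous_on (cball 0 1) Ln_kernel"
proof (intro continuous_at_imp_continuous_on ballI)
  fix z :: complex
  assume z: "z \<in> cball 0 1"
  show "isCont Ln_kernel z"
  proof (cases "z = - 1")
    case True
    have "filterlim (\<lambda>z::complex. 1 + z) (at 0) (at (- 1))"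
      by (auto simp: filterlim_at eventually_at_filter add_eq_0_iff intro!: tendsto_eq_intros)
    then have "((\<lambda>z. (1 + z)\<^sup>2 * Ln (1 + z) / z) \<longlongrightarrow> 0 / (- 1)) (at (- 1))"
      by (intro tendsto_intros filterlim_compose[OF tendsto_power2_mult_Ln]) auto
    moreover have "\<forall>\<^sub>F z in at (- 1). (1 + z)\<^sup>2 * Ln (1 + z) / z = Ln_kernel z"
      using eventually_neq_at_within[of 0 "- 1" UNIV] by eventually_elim (simp add: Ln_kernel_def)
    ultimately have "(Ln_kernel \<longlongrightarrow> 0) (at (- 1))"
      by (simp add: Lim_transform_eventually)
    then show ?thesis
      by (simp add: True isCont_def Ln_kernel_def)
  next
    case False
    have "1 + z \<notin> \<real>\<^sub>\<le>\<^sub>0"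
    proof
      assume "1 + z \<in> \<real>\<^sub>\<le>\<^sub>0"
      then have "Re z \<le> - 1" "Im z = 0"
        by (auto simp: complex_nonpos_Reals_iff)
      moreover from this have "Re z = - 1"
        using z abs_Re_le_cmod[of z] by simp
      ultimately show False
        using False by (simp add: complex_eq_iff)
    qed
    then show ?thesis
      using holomorphic_on_imp_continuous_on[OF Ln_kernel_holomorphic] open_Ln_kernel_domain
      by (simp add: continuous_on_eq_continuous_at)
  qed
qed

lemma Ln_kernel_holomorphic_ball: "Ln_kernel holomorphic_on ball 0 1"
proof (rule holomorphic_on_subset[OF Ln_kernel_holomorphic], rule subsetI, rule CollectI, rule notI)
  fix z :: complex
  assume "z \<in> ball 0 1" "1 + z \<in> \<real>\<^sub>\<le>\<^sub>0"
  then show False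
    using abs_Re_le_cmod[of z] by (auto simp: complex_nonpos_Reals_iff)
qed

lemma Re_Ln_kernel:
  assumes "norm z = 1"
  shows "2 * Re (Ln_kernel z) = entropy_fun (norm (1 + z))"
proof (cases "1 + z = 0")
  case False
  have z: "z * cnj z = 1" "z \<noteq> 0"
    using complex_norm_square[of z] assms by auto
  have "complex_of_real ((norm (1 + z))\<^sup>2) * z = (1 + z)\<^sup>2"
    unfolding complex_norm_square using z by (simp add: algebra_simps power2_eq_square)
  then have "Ln_kernel z = complex_of_real ((norm (1 + z))\<^sup>2) * Ln (1 + z)"
    using z(2) by (simp add: Ln_kernel_def divide_eq_eq mult_ac flip: \<open>_ = (1 + z)\<^sup>2\<close>)
  then show ?thesis
    using False by (simp add: entropy_fun_def ln_realpow del: of_real_power)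
qed (simp add: Ln_kernel_def entropy_fun_def)

lemma integral_cos_sq: "(\<integral>t. (cos t)\<^sup>2 \<partial>arc_measure) = 1 / 2"
proof -
  have square: "(cos t)\<^sup>2 = (1 + cos (real 2 * t)) / 2" for t :: real
    by (simp add: cos_double_cos)
  have "integrable arc_measure (\<lambda>t. cos (real 2 * t))"
    by (intro integrable_arc_measure_continuous continuous_intros)
  then show ?thesis
    unfolding square using integral_cos_multiple_arc_measure[of 2] by simp
qed

lemma integral_entropy_fun_sqrt2_cos: "(\<integral>t. entropy_fun (sqrt 2 * cos t) \<partial>arc_measure) = 1 - ln 2"
proof -
  have entropy: "2 * Re (Ln_kernel (cis (2 * t)))
      = 2 * entropy_fun (sqrt 2 * cos t) + 4 * ln 2 * (cos t)\<^sup>2" for t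
  proof -
    have "1 + cis (2 * t) = 2 * complex_of_real (cos t) * cis t"
      by (simp add: complex_eq_iff cos_double_cos sin_double power2_eq_square)
    then have "2 * Re (Ln_kernel (cis (2 * t))) = entropy_fun (2 * \<bar>cos t\<bar>)"
      by (simp add: Re_Ln_kernel norm_mult)
    also have "\<dots> = entropy_fun (sqrt 2 * (sqrt 2 * cos t))"
      by (simp add: entropy_fun_def power_mult_distrib flip: mult.assoc)
    finally show ?thesis
      by (simp add: entropy_fun_mult[of "sqrt 2"] power_mult_distrib)
  qed
  have "integrable arc_measure (\<lambda>t. Ln_kernel (cis (2 * t)))"
    by (intro integrable_arc_measure_continuous continuous_on_compose_cis continuous_on_Ln_kernel)
  then have "(\<integral>t. 2 * Re (Ln_kernel (cis (2 * t))) \<partial>arc_measure)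
      = 2 * Re (\<integral>t. Ln_kernel (cis (2 * t)) \<partial>arc_measure)"
    by simp
  also have "\<dots> = 2"
    by (simp add: integral_holomorphic_cis_double continuous_on_Ln_kernel Ln_kernel_holomorphic_ball)
      (simp add: Ln_kernel_def)
  finally have "(\<integral>t. 2 * entropy_fun (sqrt 2 * cos t) + 4 * ln 2 * (cos t)\<^sup>2 \<partial>arc_measure) = 2"
    by (simp only: entropy)
  moreover have "integrable arc_measure (\<lambda>t. entropy_fun (sqrt 2 * cos t))"
      "integrable arc_measure (\<lambda>t. (cos t)\<^sup>2)"
    by (intro integrable_arc_measure_continuous continuous_intros)+
  ultimately show ?thesis
    by (simp add: integral_cos_sq)
qed

lemma integral_entropy_fun_oscillation_tendsto:
  assumes "u \<in> borel_measurable borel" "\<And>t. norm (u t) = 1"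
  shows "(\<lambda>n. \<integral>t. entropy_fun (sqrt 2 * oscillation u n t) \<partial>arc_measure) \<longlonglongrightarrow> 1 - ln 2"
proof -
  have "(\<lambda>n. \<integral>t. 1 * entropy_fun (sqrt 2 * oscillation u n t) \<partial>arc_measure)
      \<longlonglongrightarrow> (\<integral>t. 1 \<partial>arc_measure) * (\<integral>t. entropy_fun (sqrt 2 * cos t) \<partial>arc_measure)"
    by (rule unimodular_oscillation_equidistributed[OF assms, where \<phi>="\<lambda>x. entropy_fun (sqrt 2 * x)"])
      (auto intro!: continuous_intros)
  then show ?thesis
    by (simp add: integral_entropy_fun_sqrt2_cos)
qed

lemma integral_mult_oscillation_sq_tendsto:
  assumes "u \<in> borel_measurable borel" "\<And>t. norm (u t) = 1" and f: "integrable arc_measure f"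
  shows "(\<lambda>n. \<integral>t. f t * (sqrt 2 * oscillation u n t)\<^sup>2 \<partial>arc_measure) \<longlonglongrightarrow> (\<integral>t. f t \<partial>arc_measure)"
proof -
  have "(\<lambda>n. \<integral>t. f t * (sqrt 2 * oscillation u n t)\<^sup>2 \<partial>arc_measure)
      \<longlonglongrightarrow> (\<integral>t. f t \<partial>arc_measure) * (\<integral>t. (sqrt 2 * cos t)\<^sup>2 \<partial>arc_measure)"
    by (rule unimodular_oscillation_equidistributed[OF assms, where \<phi>="\<lambda>x. (sqrt 2 * x)\<^sup>2"])
      (intro continuous_intros)
  then show ?thesis
    by (simp add: power_mult_distrib integral_cos_sq)
qed

section \<open>The pointwise entropy gap\<close>

lemma continuous_compose_diff_tendsto_0:
  fixes \<phi> :: "real \<Rightarrow> real" and x y :: "nat \<Rightarrow> real"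
  assumes \<phi>: "continuous_on UNIV \<phi>" and y: "\<And>k. \<bar>y k\<bar> \<le> c" and lim: "(\<lambda>k. x k - y k) \<longlonglongrightarrow> 0"
  shows "(\<lambda>k. \<phi> (x k) - \<phi> (y k)) \<longlonglongrightarrow> 0"
proof -
  obtain B where B: "\<And>k. \<bar>x k - y k\<bar> \<le> B"
    using convergent_imp_Bseq[OF convergentI[OF lim]] unfolding Bseq_def by auto
  have "x k \<in> {- (c + B)..c + B}" "y k \<in> {- (c + B)..c + B}" for k
    using B[of k] y[of k] by (auto simp: abs_le_iff)
  moreover have "uniformly_continuous_on {- (c + B)..c + B} \<phi>"
    by (intro compact_uniformly_continuous continuous_on_subset[OF \<phi>]) auto
  ultimately have "(\<lambda>k. dist (\<phi> (x k)) (\<phi> (y k))) \<longlonglongrightarrow> 0"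
    using tendsto_norm_zero[OF lim] unfolding uniformly_continuous_on_sequentially by (simp add: dist_norm)
  then show ?thesis
    unfolding dist_norm by (rule tendsto_norm_zero_cancel)
qed

lemma log_plus_excess_bounds:
  assumes "0 \<le> x"
  shows "0 \<le> x * (log_plus x - ln x)" "x * (log_plus x - ln x) \<le> 1"
proof -
  show "0 \<le> x * (log_plus x - ln x)"
    using assms by (simp add: log_plus_def)
  show "x * (log_plus x - ln x) \<le> 1"
  proof (cases "x = 0 \<or> 1 \<le> x")
    case False
    then have x: "0 < x" "x < 1"
      using assms by auto
    have "- ln x \<le> 1 / x - 1"
      using ln_le_minus_one[of "1 / x"] x by (simp add: ln_div)
    then have "x * (- ln x) \<le> x * (1 / x - 1)"
      using x by (intro mult_left_mono) auto
    then show ?thesis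
      using x by (simp add: log_plus_def max_def algebra_simps)
  qed (auto simp: log_plus_def)
qed

text \<open>\<open>x\<close> stands for \<open>p\<^sub>n(cos t)\<close>, \<open>w\<close> for the weight and \<open>y\<close> for the oscillation approximating \<open>x sqrt w\<close>.\<close>
definition entropy_gap :: "real \<Rightarrow> real \<Rightarrow> real \<Rightarrow> real \<Rightarrow> real" where
  "entropy_gap M x w y =
    (if M \<le> \<bar>x * sqrt w\<bar> then x\<^sup>2 * log_plus (x\<^sup>2) * w else 0) - entropy_fun x * w + entropy_fun y - ln w * y\<^sup>2"

lemma entropy_gap_below:
  assumes "0 < w" "\<bar>x * sqrt w\<bar> < M"
  shows "entropy_gap M x w y = entropy_fun y - entropy_fun (x * sqrt w) + ln w * ((x * sqrt w)\<^sup>2 - y\<^sup>2)"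
proof -
  have "entropy_fun (x * sqrt w) = entropy_fun x * w + ln w * (x * sqrt w)\<^sup>2"
    using assms(1) entropy_fun_mult[of "sqrt w" x] by (simp add: power_mult_distrib mult_ac)
  then show ?thesis
    using assms(2) by (simp add: entropy_gap_def algebra_simps)
qed

lemma abs_entropy_gap_le:
  assumes w: "0 < w" and y: "\<bar>y\<bar> \<le> M" and K: "\<And>z. \<bar>z\<bar> \<le> M \<Longrightarrow> \<bar>entropy_fun z\<bar> \<le> K"
  shows "\<bar>entropy_gap M x w y\<bar> \<le> w + 2 * K + 2 * M\<^sup>2 * \<bar>ln w\<bar>"
proof -
  have ln_w_sq: "\<bar>ln w * z\<^sup>2\<bar> \<le> M\<^sup>2 * \<bar>ln w\<bar>" if "\<bar>z\<bar> \<le> M" for z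
  proof -
    have "z\<^sup>2 \<le> M\<^sup>2"
      using power_mono[OF that abs_ge_zero, of 2] by simp
    then show ?thesis
      by (simp add: abs_mult mult.commute mult_left_mono)
  qed
  show ?thesis
  proof (cases "M \<le> \<bar>x * sqrt w\<bar>")
    case True
    define r where "r = x\<^sup>2 * (log_plus (x\<^sup>2) - ln (x\<^sup>2))"
    have "0 \<le> r * w" "r * w \<le> w"
      using w log_plus_excess_bounds[of "x\<^sup>2"] by (auto simp: r_def mult_le_cancel_right1)
    moreover have "entropy_gap M x w y = r * w + entropy_fun y - ln w * y\<^sup>2"
      using True by (simp add: entropy_gap_def entropy_fun_def r_def algebra_simps)
    ultimately show ?thesis
      using K[OF y] ln_w_sq[OF y] by (simp add: abs_le_iff)
  next
    case False
    then have x: "\<bar>x * sqrt w\<bar> \<le> M"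
      by simp
    show ?thesis
      using entropy_gap_below[OF w, of x M y] False w K[OF x] K[OF y] ln_w_sq[OF x] ln_w_sq[OF y]
      by (simp add: right_diff_distrib abs_le_iff)
  qed
qed

lemma entropy_gap_tendsto_0:
  assumes w: "0 < w" and y: "\<And>k. \<bar>y k\<bar> \<le> c" "c < M" and lim: "(\<lambda>k::nat. x k * sqrt w - y k) \<longlonglongrightarrow> 0"
  shows "(\<lambda>k. entropy_gap M (x k) w (y k)) \<longlonglongrightarrow> 0"
proof -
  have "\<forall>\<^sub>F k in sequentially. \<bar>x k * sqrt w - y k\<bar> < M - c"
    using order_tendstoD(2)[OF tendsto_rabs[OF lim], of "M - c"] y(2) by simp
  then have gap_eq: "\<forall>\<^sub>F k in sequentially. - (entropy_fun (x k * sqrt w) - entropy_fun (y k))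
      + ln w * ((x k * sqrt w)\<^sup>2 - (y k)\<^sup>2) = entropy_gap M (x k) w (y k)"
  proof eventually_elim
    case (elim k)
    then have "\<bar>x k * sqrt w\<bar> < M"
      using y(1)[of k] by linarith
    then show ?case
      using entropy_gap_below[OF w] by simp
  qed
  have "(\<lambda>k. - (entropy_fun (x k * sqrt w) - entropy_fun (y k))
      + ln w * ((x k * sqrt w)\<^sup>2 - (y k)\<^sup>2)) \<longlonglongrightarrow> - 0 + ln w * 0"
    by (intro tendsto_intros continuous_compose_diff_tendsto_0[OF continuous_on_entropy_fun y(1) lim]
        continuous_compose_diff_tendsto_0[where \<phi>="\<lambda>x. x\<^sup>2", OF _ y(1) lim] continuous_intros)
  from Lim_transform_eventually[OF this gap_eq] show ?thesis
    by simp
qed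

section \<open>Dominated convergence along a sequence vanishing in \<open>L\<^sup>1\<close>\<close>

lemma LIMSEQ_subseqI:
  fixes X :: "nat \<Rightarrow> 'a::topological_space"
  assumes subseq: "\<And>s. strict_mono s \<Longrightarrow> \<exists>r. strict_mono (r :: nat \<Rightarrow> nat) \<and> (\<lambda>k. X (s (r k))) \<longlonglongrightarrow> l"
  shows "X \<longlonglongrightarrow> l"
proof (rule topological_tendstoI, rule ccontr)
  fix S
  assume S: "open S" "l \<in> S" and "\<not> (\<forall>\<^sub>F n in sequentially. X n \<in> S)"
  then have exceptions: "infinite {n. X n \<notin> S}"
    by (simp add: frequently_cofinite[symmetric] cofinite_eq_sequentially frequently_def)
  define s where "s = enumerate {n. X n \<notin> S}"
  have "strict_mono s"
    unfolding s_def by (rule strict_mono_enumerate[OF exceptions])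
  then obtain r where "(\<lambda>k. X (s (r k))) \<longlonglongrightarrow> l"
    using subseq by blast
  then have "\<forall>\<^sub>F k in sequentially. X (s (r k)) \<in> S"
    using S by (rule topological_tendstoD)
  moreover have "X (s (r k)) \<notin> S" for k
    using enumerate_in_set[OF exceptions, of "r k"] by (simp add: s_def)
  ultimately show False
    by simp
qed

lemma integral_tendsto_0_dominated_L1:
  fixes X :: "nat \<Rightarrow> 'a \<Rightarrow> 'b::{banach, second_countable_topology}"
    and D :: "nat \<Rightarrow> 'a \<Rightarrow> 'c::{banach, second_countable_topology}"
  assumes D: "\<And>n. integrable M (D n)" "(\<lambda>n. \<integral>x. norm (D n x) \<partial>M) \<longlonglongrightarrow> 0"
    and X: "\<And>n. X n \<in> borel_measurable M" "integrable M W" "\<And>n. AE x in M. norm (X n x) \<le> W x"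
    and lim: "AE x in M. \<forall>s. (\<lambda>k. D (s k) x) \<longlonglongrightarrow> 0 \<longrightarrow> (\<lambda>k. X (s k) x) \<longlonglongrightarrow> 0"
  shows "(\<lambda>n. \<integral>x. X n x \<partial>M) \<longlonglongrightarrow> 0"
proof (rule LIMSEQ_subseqI)
  fix s :: "nat \<Rightarrow> nat"
  assume "strict_mono s"
  then have "(\<lambda>k. \<integral>x. norm (D (s k) x) \<partial>M) \<longlonglongrightarrow> 0"
    using LIMSEQ_subseq_LIMSEQ[OF D(2)] by (simp add: o_def)
  then obtain r where r: "strict_mono r" and D_lim: "AE x in M. (\<lambda>k. D (s (r k)) x) \<longlonglongrightarrow> 0"
    using tendsto_L1_AE_subseq[of M "\<lambda>k. D (s k)"] D(1) by blast
  have "AE x in M. (\<lambda>k. X (s (r k)) x) \<longlonglongrightarrow> 0"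
    using D_lim lim by eventually_elim (drule spec[of _ "\<lambda>k. s (r k)"], blast)
  then have "(\<lambda>k. \<integral>x. X (s (r k)) x \<partial>M) \<longlonglongrightarrow> (\<integral>x. 0 \<partial>M)"
    using X by (intro integral_dominated_convergence[where w=W]) auto
  with r show "\<exists>r. strict_mono r \<and> (\<lambda>k. \<integral>x. X (s (r k)) x \<partial>M) \<longlonglongrightarrow> 0"
    by auto
qed

section \<open>Entropy asymptotics on the arc\<close>

lemma borel_measurable_log_plus [measurable]: "log_plus \<in> borel_measurable borel"
  unfolding log_plus_def[abs_def] by measurable

context Szego_orthonormal
begin

definition truncated_log_plus :: "real \<Rightarrow> nat \<Rightarrow> real \<Rightarrow> real" where
  "truncated_log_plus M n t =
    (if M \<le> \<bar>weighted_p n t\<bar> then (poly (p n) (cos t))\<^sup>2 * log_plus ((poly (p n) (cos t))\<^sup>2) * v t else 0)"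

lemma entropy_integrable: "integrable arc_measure (\<lambda>t. entropy_fun (poly (p n) (cos t)) * v t)"
  using integrable_mult_continuous_cos[OF v_integrable, of "\<lambda>x. entropy_fun (poly (p n) x)"]
  by (simp add: continuous_on_compose_entropy_fun continuous_on_poly mult.commute)

lemma truncated_log_plus_integrable: "integrable arc_measure (truncated_log_plus M n)"
proof (rule Bochner_Integration.integrable_bound[OF entropy_integrable])
  have "\<bar>log_plus x\<bar> \<le> \<bar>ln x\<bar>" for x
    by (simp add: log_plus_def)
  then show "AE t in arc_measure. norm (truncated_log_plus M n t)
      \<le> norm (entropy_fun (poly (p n) (cos t)) * v t)"
    by (auto intro!: AE_I2 mult_right_mono mult_left_mono simp: truncated_log_plus_def entropy_fun_def abs_mult)
  show "truncated_log_plus M n \<in> borel_measurable arc_measure"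
    unfolding truncated_log_plus_def[abs_def] by measurable
qed

lemma integral_entropy_gap_tendsto_0:
  assumes M: "sqrt 2 < M" and [measurable]: "u \<in> borel_measurable borel" and u: "\<And>t. norm (u t) = 1"
    and L2: "(\<lambda>n. \<integral>t. (weighted_p n t - sqrt 2 * oscillation u n t)\<^sup>2 \<partial>arc_measure) \<longlonglongrightarrow> 0"
  shows "(\<lambda>n. \<integral>t. entropy_gap M (poly (p n) (cos t)) (v t) (sqrt 2 * oscillation u n t) \<partial>arc_measure) \<longlonglongrightarrow> 0"
proof -
  have osc: "\<bar>sqrt 2 * oscillation u n t\<bar> \<le> sqrt 2" for n t
    using abs_oscillation_le[of u n t] by (simp add: abs_mult u)
  obtain K where "\<And>z. z \<in> {- M..M} \<Longrightarrow> norm (entropy_fun z) \<le> K"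
    using continuous_on_compact_bound[OF compact_Icc
        continuous_on_subset[OF continuous_on_entropy_fun subset_UNIV]]
    by blast
  then have K: "\<bar>entropy_fun z\<bar> \<le> K" if "\<bar>z\<bar> \<le> M" for z
    using that by (simp add: abs_le_iff)
  show ?thesis
  proof (rule integral_tendsto_0_dominated_L1
      [where D="\<lambda>n t. (weighted_p n t - sqrt 2 * oscillation u n t)\<^sup>2"
        and W="\<lambda>t. v t + 2 * K + 2 * M\<^sup>2 * \<bar>ln (v t)\<bar>"])
    show "integrable arc_measure (\<lambda>t. (weighted_p n t - sqrt 2 * oscillation u n t)\<^sup>2)" for n
      by (rule weighted_p_diff_oscillation_sq_integrable[OF _ u]) measurable
    show "integrable arc_measure (\<lambda>t. v t + 2 * K + 2 * M\<^sup>2 * \<bar>ln (v t)\<bar>)"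
      using v_integrable ln_v_integrable by simp
    show "AE t in arc_measure. norm (entropy_gap M (poly (p n) (cos t)) (v t) (sqrt 2 * oscillation u n t))
        \<le> v t + 2 * K + 2 * M\<^sup>2 * \<bar>ln (v t)\<bar>" for n
      using v_pos
    proof eventually_elim
      case (elim t)
      have "\<bar>sqrt 2 * oscillation u n t\<bar> \<le> M"
        using osc[of n t] M by linarith
      then show ?case
        using abs_entropy_gap_le[OF elim] K by simp
    qed
    show "AE t in arc_measure. \<forall>s. (\<lambda>k. (weighted_p (s k) t - sqrt 2 * oscillation u (s k) t)\<^sup>2) \<longlonglongrightarrow> 0 \<longrightarrow>
        (\<lambda>k. entropy_gap M (poly (p (s k)) (cos t)) (v t) (sqrt 2 * oscillation u (s k) t)) \<longlonglongrightarrow> 0"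
      using v_pos
      by eventually_elim (auto simp: power_tendsto_0_iff weighted_p_def
        intro!: entropy_gap_tendsto_0[OF _ osc M])
    show "(\<lambda>t. entropy_gap M (poly (p n) (cos t)) (v t) (sqrt 2 * oscillation u n t))
      \<in> borel_measurable arc_measure" for n
      unfolding entropy_gap_def by measurable
  qed (use L2 in simp)
qed

lemma integral_entropy_gap:
  assumes [measurable]: "u \<in> borel_measurable borel" and u: "\<And>t. norm (u t) = 1"
  shows "(\<integral>t. entropy_gap M (poly (p n) (cos t)) (v t) (sqrt 2 * oscillation u n t) \<partial>arc_measure)
    = (\<integral>t. truncated_log_plus M n t \<partial>arc_measure) - (\<integral>t. entropy_fun (poly (p n) (cos t)) * v t \<partial>arc_measure)
      + (\<integral>t. entropy_fun (sqrt 2 * oscillation u n t) \<partial>arc_measure)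
      - (\<integral>t. ln (v t) * (sqrt 2 * oscillation u n t)\<^sup>2 \<partial>arc_measure)"
proof -
  have osc_integrable: "integrable arc_measure (\<lambda>t. f t * \<phi> (sqrt 2 * oscillation u n t))"
    if "integrable arc_measure f" "continuous_on UNIV \<phi>" for f \<phi> :: "real \<Rightarrow> real"
  proof (rule integrable_mult_continuous_compose[OF that])
    have "\<bar>sqrt 2 * oscillation u n t\<bar> \<le> sqrt 2" for t
      using abs_oscillation_le[of u n t] by (simp add: abs_mult u)
    from abs_le_D1[OF this] abs_le_D2[OF this] show "sqrt 2 * oscillation u n t \<in> {- sqrt 2..sqrt 2}" for t
      unfolding atLeastAtMost_iff minus_le_iff[of "sqrt 2"] by (intro conjI)
  qed simp
  have "entropy_gap M (poly (p n) (cos t)) (v t) (sqrt 2 * oscillation u n t)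
      = truncated_log_plus M n t - entropy_fun (poly (p n) (cos t)) * v t
        + entropy_fun (sqrt 2 * oscillation u n t) - ln (v t) * (sqrt 2 * oscillation u n t)\<^sup>2" for t
    by (simp add: entropy_gap_def truncated_log_plus_def weighted_p_def)
  moreover have "integrable arc_measure (\<lambda>t. ln (v t) * (sqrt 2 * oscillation u n t)\<^sup>2)"
    by (intro osc_integrable ln_v_integrable continuous_intros)
  moreover have "integrable arc_measure (\<lambda>t. entropy_fun (sqrt 2 * oscillation u n t))"
    using osc_integrable[of "\<lambda>_. 1", OF _ continuous_on_entropy_fun] by simp
  ultimately show ?thesis
    by (simp add: truncated_log_plus_integrable entropy_integrable)
qed

theorem entropy_asymptotics:
  assumes M: "sqrt 2 < M"
  shows "(\<lambda>n. - (\<integral>t. entropy_fun (poly (p n) (cos t)) * v t \<partial>arc_measure)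
    - ((\<integral>t. ln (v t) \<partial>arc_measure) + ln 2 - 1 - (\<integral>t. truncated_log_plus M n t \<partial>arc_measure))) \<longlonglongrightarrow> 0"
proof -
  obtain u where u: "u \<in> borel_measurable borel" "\<And>t. norm (u t) = 1"
    and L2: "(\<lambda>n. \<integral>t. (weighted_p n t - sqrt 2 * oscillation u n t)\<^sup>2 \<partial>arc_measure) \<longlonglongrightarrow> 0"
    using L2_asymptotics by blast
  define G where "G n = (\<integral>t. entropy_gap M (poly (p n) (cos t)) (v t)
      (sqrt 2 * oscillation u n t) \<partial>arc_measure)" for n
  define E where "E n = (\<integral>t. entropy_fun (sqrt 2 * oscillation u n t) \<partial>arc_measure)" for n
  define L where "L n = (\<integral>t. ln (v t) * (sqrt 2 * oscillation u n t)\<^sup>2 \<partial>arc_measure)" for n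
  have "G \<longlonglongrightarrow> 0" "E \<longlonglongrightarrow> 1 - ln 2" "L \<longlonglongrightarrow> (\<integral>t. ln (v t) \<partial>arc_measure)"
    unfolding G_def[abs_def] E_def[abs_def] L_def[abs_def]
    by (intro integral_entropy_gap_tendsto_0 integral_entropy_fun_oscillation_tendsto
        integral_mult_oscillation_sq_tendsto M u L2 ln_v_integrable)+
  then have "(\<lambda>n. G n - (E n - (1 - ln 2)) + (L n - (\<integral>t. ln (v t) \<partial>arc_measure))) \<longlonglongrightarrow> 0 - 0 + 0"
    by (intro tendsto_add tendsto_diff LIM_zero)
  moreover have "G n = (\<integral>t. truncated_log_plus M n t \<partial>arc_measure)
      - (\<integral>t. entropy_fun (poly (p n) (cos t)) * v t \<partial>arc_measure) + E n - L n" for n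
    unfolding G_def E_def L_def by (rule integral_entropy_gap[OF u])
  ultimately show ?thesis
    by (simp add: algebra_simps)
qed

end

section \<open>Transfer to the interval\<close>

text \<open>The absolute value makes the weight nonnegative everywhere rather than almost everywhere.\<close>
definition arc_weight :: "(real \<Rightarrow> real) \<Rightarrow> real \<Rightarrow> real" where
  "arc_weight w t = \<bar>w_zero w (cos t)\<bar>"

lemma arc_weight_eq:
  assumes "AE x in lborel. x \<in> {-1..1} \<longrightarrow> 0 < w_zero w x"
  shows "AE t in arc_measure. 0 < arc_weight w t \<and> w_zero w (cos t) = arc_weight w t"
  using AE_arc_measure_cos[OF assms] by eventually_elim (simp add: arc_weight_def)

lemma measurable_cos_Icc [measurable]: "cos \<in> borel \<rightarrow>\<^sub>M restrict_space borel {-1..1::real}"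
  by (rule measurable_restrict_space2) auto

lemma measurable_id_restrict_borel: "(\<lambda>x. x) \<in> restrict_space borel A \<rightarrow>\<^sub>M borel"
  by (rule measurable_restrict_space1) simp

lemma borel_measurable_w_zero [measurable]:
  assumes [measurable]: "w \<in> borel_measurable (restrict_space borel {-1..1})"
  shows "w_zero w \<in> borel_measurable (restrict_space borel {-1..1})"
  using measurable_id_restrict_borel[measurable] unfolding w_zero_def[abs_def] by measurable

lemma borel_measurable_arc_weight [measurable]:
  assumes [measurable]: "w \<in> borel_measurable (restrict_space borel {-1..1})"
  shows "arc_weight w \<in> borel_measurable borel"
  unfolding arc_weight_def[abs_def] by measurable

lemma AE_w_zero_mult_cheb_rho: "AE x in lborel. x \<in> {-1..1} \<longrightarrow> w_zero w x * cheb_rho x = w x"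
proof -
  have "AE x in lborel. x \<noteq> (- 1 :: real) \<and> x \<noteq> 1"
    by (intro AE_conjI AE_lborel_singleton)
  then show ?thesis
    by eventually_elim (auto simp: w_zero_def cheb_rho_def power2_eq_1_iff)
qed

lemma
  fixes f g :: "real \<Rightarrow> real"
  assumes f: "f \<in> borel_measurable (restrict_space borel {-1..1})"
    and g: "g \<in> borel_measurable (restrict_space borel {-1..1})"
    and f_eq_g: "AE x in lborel. x \<in> {-1..1} \<longrightarrow> f x = g x"
  shows set_integrable_Icc_cong_AE: "set_integrable lborel {-1..1} f \<longleftrightarrow> set_integrable lborel {-1..1} g"
    and set_lebesgue_integral_Icc_cong_AE: "(LINT x:{-1..1}|lborel. f x) = (LINT x:{-1..1}|lborel. g x)"
proof -
  have fg: "(\<lambda>x. indicator {-1..1} x *\<^sub>R f x) \<in> borel_measurable lborel"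
      "(\<lambda>x. indicator {-1..1} x *\<^sub>R g x) \<in> borel_measurable lborel"
    using f g by (simp_all add: borel_measurable_restrict_space_iff)
  have ind_eq: "AE x in lborel. indicator {-1..1} x *\<^sub>R f x = indicator {-1..1} x *\<^sub>R g x"
    using f_eq_g by eventually_elim (simp split: split_indicator)
  show "set_integrable lborel {-1..1} f \<longleftrightarrow> set_integrable lborel {-1..1} g"
    unfolding set_integrable_def by (rule integrable_cong_AE[OF fg ind_eq])
  show "(LINT x:{-1..1}|lborel. f x) = (LINT x:{-1..1}|lborel. g x)"
    unfolding set_lebesgue_integral_def by (rule integral_cong_AE[OF fg ind_eq])
qed

lemma
  assumes w [measurable]: "w \<in> borel_measurable (restrict_space borel {-1..1})"
    and w_zero_pos: "AE x in lborel. x \<in> {-1..1} \<longrightarrow> 0 < w_zero w x"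
    and f [measurable]: "f \<in> borel_measurable (restrict_space borel {-1..1})"
  shows integrable_arc_weight_iff:
      "integrable arc_measure (\<lambda>t. f (cos t) * arc_weight w t) \<longleftrightarrow> set_integrable lborel {-1..1} (\<lambda>x. f x * w x)"
    and integral_arc_weight:
      "(\<integral>t. f (cos t) * arc_weight w t \<partial>arc_measure) = (LINT x:{-1..1}|lborel. f x * w x)"
proof -
  have [measurable]: "cheb_rho \<in> borel_measurable (restrict_space borel {-1..1})"
    by (rule measurable_restrict_space1) measurable
  have arc: "AE t in arc_measure. f (cos t) * arc_weight w t = f (cos t) * w_zero w (cos t)"
    using arc_weight_eq[OF w_zero_pos] by eventually_elim simp
  have interval: "AE x in lborel. x \<in> {-1..1} \<longrightarrow> f x * w_zero w x * cheb_rho x = f x * w x"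
    using AE_w_zero_mult_cheb_rho[of w] by eventually_elim (simp add: mult.assoc)
  have "integrable arc_measure (\<lambda>t. f (cos t) * arc_weight w t)
      \<longleftrightarrow> integrable arc_measure (\<lambda>t. f (cos t) * w_zero w (cos t))"
    by (rule integrable_cong_AE[OF _ _ arc]) measurable
  also have "\<dots> \<longleftrightarrow> set_integrable lborel {-1..1} (\<lambda>x. f x * w_zero w x * cheb_rho x)"
    by (rule integrable_arc_measure_cos_iff) measurable
  also have "\<dots> \<longleftrightarrow> set_integrable lborel {-1..1} (\<lambda>x. f x * w x)"
    by (rule set_integrable_Icc_cong_AE[OF _ _ interval]) measurable
  finally show "integrable arc_measure (\<lambda>t. f (cos t) * arc_weight w t)
      \<longleftrightarrow> set_integrable lborel {-1..1} (\<lambda>x. f x * w x)" .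
  have "(\<integral>t. f (cos t) * arc_weight w t \<partial>arc_measure) = (\<integral>t. f (cos t) * w_zero w (cos t) \<partial>arc_measure)"
    by (rule integral_cong_AE[OF _ _ arc]) measurable
  also have "\<dots> = (LINT x:{-1..1}|lborel. f x * w_zero w x * cheb_rho x)"
    by (rule integral_arc_measure_cos) measurable
  also have "\<dots> = (LINT x:{-1..1}|lborel. f x * w x)"
    by (rule set_lebesgue_integral_Icc_cong_AE[OF _ _ interval]) measurable
  finally show "(\<integral>t. f (cos t) * arc_weight w t \<partial>arc_measure) = (LINT x:{-1..1}|lborel. f x * w x)" .
qed

locale Szego_interval =
  fixes w :: "real \<Rightarrow> real" and p :: "nat \<Rightarrow> real poly"
  assumes w_integrable: "set_integrable lborel {-1..1} w"
    and w_zero_pos: "AE x in lborel. x \<in> {-1..1} \<longrightarrow> 0 < w_zero w x"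
    and ln_w_zero_integrable: "set_integrable lborel {-1..1} (\<lambda>x. ln (w_zero w x) * cheb_rho x)"
    and orthonormal_polys: "orthonormal_polys w p"
begin

lemma w_measurable [measurable]: "w \<in> borel_measurable (restrict_space borel {-1..1})"
  using borel_measurable_integrable[OF w_integrable[unfolded set_integrable_def]]
  by (simp add: borel_measurable_restrict_space_iff)

lemma set_integral_borel_mult_w:
  assumes [measurable]: "f \<in> borel_measurable borel"
  shows "(LINT x:{-1..1}|lborel. f x * w x) = (\<integral>t. f (cos t) * arc_weight w t \<partial>arc_measure)"
  by (rule integral_arc_weight[OF w_measurable w_zero_pos, symmetric])
    (rule measurable_restrict_space1[OF assms])

lemma AE_ln_w_zero_cos: "AE t in arc_measure. ln (w_zero w (cos t)) = ln (arc_weight w t)"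
  using arc_weight_eq[OF w_zero_pos] by eventually_elim simp

lemma mutual_entropy_S_eq: "mutual_entropy_S w = (\<integral>t. ln (arc_weight w t) \<partial>arc_measure)"
proof -
  have "mutual_entropy_S w = (\<integral>t. ln (w_zero w (cos t)) \<partial>arc_measure)"
    unfolding mutual_entropy_S_def by (rule integral_arc_measure_cos[symmetric]) measurable
  also have "\<dots> = (\<integral>t. ln (arc_weight w t) \<partial>arc_measure)"
    by (rule integral_cong_AE[OF _ _ AE_ln_w_zero_cos]) measurable
  finally show ?thesis .
qed

sublocale Szego_orthonormal "arc_weight w" p
proof
  show "integrable arc_measure (arc_weight w)"
    using integrable_arc_weight_iff[OF w_measurable w_zero_pos, of "\<lambda>_. 1"] w_integrable by simp
  show "integrable arc_measure (\<lambda>t. ln (arc_weight w t))"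
  proof (rule integrable_cong_AE_imp)
    show "integrable arc_measure (\<lambda>t. ln (w_zero w (cos t)))"
      using ln_w_zero_integrable by (subst integrable_arc_measure_cos_iff[where f="\<lambda>x. ln (w_zero w x)"]) auto
  qed (use AE_ln_w_zero_cos in auto)
  show "AE t in arc_measure. 0 < arc_weight w t"
    using arc_weight_eq[OF w_zero_pos] by eventually_elim simp
  show "0 \<le> arc_weight w t" for t
    by (simp add: arc_weight_def)
  show "degree (p n) = n" for n
    using orthonormal_polys by (simp add: orthonormal_polys_def)
  then show "0 < coeff (p n) n" for n
    using orthonormal_polys unfolding orthonormal_polys_def by metis
  show "(\<integral>t. poly (p n) (cos t) * poly (p m) (cos t) * arc_weight w t \<partial>arc_measure)
      = (if m = n then 1 else 0)" for n m
    using orthonormal_polys set_integral_borel_mult_w[of "\<lambda>x. poly (p n) x * poly (p m) x"]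
    by (simp add: orthonormal_polys_def)
qed

lemma entropy_E_eq: "entropy_E w (p n) = - (\<integral>t. entropy_fun (poly (p n) (cos t)) * arc_weight w t \<partial>arc_measure)"
  using set_integral_borel_mult_w[of "\<lambda>x. entropy_fun (poly (p n) x)"]
  by (simp add: entropy_E_def entropy_fun_def)

lemma Delta_set_integral_eq:
  "(LINT x:Delta_set w (p n) M|lborel. (poly (p n) x)\<^sup>2 * log_plus ((poly (p n) x)\<^sup>2) * w x)
    = (\<integral>t. truncated_log_plus M n t \<partial>arc_measure)"
proof -
  define f where "f x = (if M \<le> \<bar>poly (p n) x * sqrt (w_zero w x)\<bar>
      then (poly (p n) x)\<^sup>2 * log_plus ((poly (p n) x)\<^sup>2) else 0)" for x
  have f [measurable]: "f \<in> borel_measurable (restrict_space borel {-1..1})"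
    using measurable_id_restrict_borel[measurable] unfolding f_def[abs_def] by measurable
  have "(LINT x:Delta_set w (p n) M|lborel. (poly (p n) x)\<^sup>2 * log_plus ((poly (p n) x)\<^sup>2) * w x)
      = (LINT x:{-1..1}|lborel. f x * w x)"
    unfolding set_lebesgue_integral_def
    by (intro Bochner_Integration.integral_cong refl) (auto simp: f_def Delta_set_def split: split_indicator)
  also have "\<dots> = (\<integral>t. f (cos t) * arc_weight w t \<partial>arc_measure)"
    by (rule integral_arc_weight[OF w_measurable w_zero_pos f, symmetric])
  also have "\<dots> = (\<integral>t. truncated_log_plus M n t \<partial>arc_measure)"
  proof (rule integral_cong_AE)
    show "AE t in arc_measure. f (cos t) * arc_weight w t = truncated_log_plus M n t"
      using arc_weight_eq[OF w_zero_pos]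
      by eventually_elim (simp add: f_def truncated_log_plus_def weighted_p_def)
  qed (use borel_measurable_integrable[OF truncated_log_plus_integrable] in measurable)
  finally show ?thesis .
qed

end

theorem theorem1:
  fixes w :: "real \<Rightarrow> real" and p :: "nat \<Rightarrow> real poly" and M :: real
  assumes w_int: "set_integrable lborel {-1..1} w"
    and w_nonneg: "AE x in lborel. x \<in> {-1..1} \<longrightarrow> w x \<ge> 0"
    and w_norm: "(LINT x:{-1..1}|lborel. w x) = 1"
    and szego_pos: "AE x in lborel. x \<in> {-1..1} \<longrightarrow> w_zero w x > 0"
    and szego: "set_integrable lborel {-1..1} (\<lambda>x. ln (w_zero w x) * cheb_rho x)"
    and onp: "orthonormal_polys w p"
    and M: "M > sqrt 2"
  shows "(\<lambda>n. entropy_E w (p n)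
            - (mutual_entropy_S w + ln 2 - 1
               - (LINT x:Delta_set w (p n) M|lborel.
                    (poly (p n) x)\<^sup>2 * log_plus ((poly (p n) x)\<^sup>2) * w x)))
         \<longlonglongrightarrow> 0"
proof -
  interpret Szego_interval w p
    by unfold_locales (fact w_int szego_pos szego onp)+
  show ?thesis
    unfolding entropy_E_eq mutual_entropy_S_eq Delta_set_integral_eq by (rule entropy_asymptotics[OF M])
qed

end
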